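(* Let $p\in\mathbb{C}$ with $\Re(p)>0$ and let $r>0$ be real. Then $$S_{2,p}(r)=\frac1{(2r)^2}\,S_{1,p}(r)-\frac{p^{\frac32}}{(2r)^2}\sum_{n\ge1}\left(\frac{K_3\left(2\sqrt{p(n+\mathrm{i}r)}\right)}{(n+\mathrm{i}r)^{\frac32}}+\frac{K_3\left(2\sqrt{p(n-\mathrm{i}r)}\right)}{(n-\mathrm{i}r)^{\frac32}}\right).$$
   Context: $\mathrm{i}$ is the imaginary unit, $K_\nu$ is the modified Bessel function of the second kind, $J_\nu$ is the Bessel function of the first kind; all roots and powers are principal. The $p$-extended Mathieu series is $S_{\mu,p}(r)=2\sum_{n\ge0}(-1)^n r^{2n}\binom{\mu+n}{n}\zeta_p(2\mu+2n+1)$, where $\zeta_p(s)=\frac1{\Gamma(s)}\int_0^\infty\frac{t^{s-1}e^{-p/t}}{e^t-1}\,dt$ is the $p$-extended Riemann zeta function. For all $r>0$, $\mu>0$ and $\Re(p)>0$ it is understood through its integral form $$S_{\mu,p}(r)=\frac{\sqrt\pi}{(2r)^{\mu-\frac12}\Gamma(\mu+1)}\int_0^\infty\frac{t^{\mu+\frac12}e^{-p/t}}{e^t-1}J_{\mu-\frac12}(rt)\,dt .$$ *)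

theory Defs
  imports "HOL-Analysis.Analysis"
begin

text \<open>
  Bessel functions of real order and complex argument, on the principal branch of
  \<open>(z/2)\<^sup>\<nu>\<close>. Using \<^const>\<open>rGamma\<close> (the entire function \<open>1/\<Gamma>\<close>) makes the series meaningful for
  negative integer orders too. Because \<open>0 powr 0 = 0\<close>, the order-0 functions have
  the value 0 instead of 1 at \<open>z = 0\<close>; only non-zero arguments are intended.
\<close>

definition Bessel_J :: "real \<Rightarrow> complex \<Rightarrow> complex" where
  "Bessel_J \<nu> z = (z / 2) powr of_real \<nu> *
     (\<Sum>k. (-1) ^ k * of_real (rGamma (\<nu> + real k + 1)) / fact k * (z / 2) ^ (2 * k))"

definition Bessel_I :: "real \<Rightarrow> complex \<Rightarrow> complex" where
  "Bessel_I \<nu> z = (z / 2) powr of_real \<nu> *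
     (\<Sum>k. of_real (rGamma (\<nu> + real k + 1)) / fact k * (z / 2) ^ (2 * k))"

text \<open>
  The modified Bessel function of the second kind (Macdonald function). At integer orders
  the quotient is \<open>0/0\<close> and the value is the limit in the order.
\<close>

definition Bessel_K :: "real \<Rightarrow> complex \<Rightarrow> complex" where
  "Bessel_K \<nu> z =
     (let q = (\<lambda>w. of_real (pi / 2) * (Bessel_I (- w) z - Bessel_I w z) / of_real (sin (w * pi)))
      in if \<nu> \<in> \<int> then Lim (at \<nu>) q else q \<nu>)"

text \<open>
  The \<open>p\<close>-extended Mathieu series \<open>S\<^bsub>\<mu>,p\<^esub>(r)\<close>, for \<open>\<mu> > 0\<close>, \<open>Re p > 0\<close> and \<open>r > 0\<close>,
  is given by its integral form. The series
  \<open>2 \<Sum>\<^sub>n (-1)\<^sup>n r\<^bsup>2n\<^esup> (\<mu>+n choose n) \<zeta>\<^sub>p(2\<mu>+2n+1)\<close> need not converge for large \<open>r\<close>.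
\<close>

definition ext_Mathieu :: "real \<Rightarrow> complex \<Rightarrow> real \<Rightarrow> complex" where
  "ext_Mathieu \<mu> p r =
     of_real (sqrt pi / ((2 * r) powr (\<mu> - 1 / 2) * Gamma (\<mu> + 1))) *
     (LINT t:{0<..}|lborel.
        of_real (t powr (\<mu> + 1 / 2)) * exp (- p / of_real t) / of_real (exp t - 1) *
        Bessel_J (\<mu> - 1 / 2) (of_real (r * t)))"

end

theory Submission
  imports Defs "HOL-Real_Asymp.Real_Asymp"
begin

text \<open>
Write \<open>M(s, a) = \<integral> t\<^sup>s\<^sup>-\<^sup>1 exp (- a t - p / t) dt\<close>, integrated over the positive half-line.
The Bessel functions of order 1/2 and 3/2 are elementary, and
\<open>J\<^sub>3\<^sub>/\<^sub>2(x)\<close> is proportional to \<open>(sin x / x - cos x) / sqrt x\<close>. Hence the integral for order 2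
is a multiple of the integral for order 1, which carries \<open>t sin (r t)\<close>, minus the integral of
\<open>t\<^sup>2 cos (r t) exp (- p / t) / (exp t - 1)\<close>. Expanding \<open>1 / (exp t - 1)\<close> into a geometric series and
the cosine into two exponentials turns the latter into a series of terms
\<open>(M(3, n + ir) + M(3, n - ir)) / 2\<close>; the bounds \<open>t\<^sup>2 exp (- n t)\<close>, whose integrals are \<open>2 / n\<^sup>3\<close>,
justify the interchange and give convergence. It remains to recognise \<open>M(3, a)\<close> as
\<open>2 (p / a)\<^sup>3\<^sup>/\<^sup>2 K\<^sub>3(2 sqrt (p a))\<close>.

This last identity carries the work, because \<open>K\<close> is given by power series and, at integer orders, by
a limit in the order. For a non-integer order \<open>s\<close>, the integral is cut at \<open>t = 1\<close>, and
\<open>t \<mapsto> 1 / t\<close> maps the lower part to the upper part with \<open>s\<close> negated and \<open>a, p\<close> exchanged. On the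
upper part \<open>exp (- p / t)\<close> is expanded, which leaves incomplete Gamma integrals of orders \<open>s - k\<close>; each
is a complete Gamma value minus a power series in \<open>a\<close>. The two resulting double series, one from
each part, are negatives of each other and cancel. The Gamma values become reciprocal
Gamma values by the reflection formula, and what is left are exactly the series of \<open>I\<^sub>-\<^sub>s\<close> and \<open>I\<^sub>s\<close>. Since the integral is
continuous in \<open>s\<close>, the limit defining \<open>K\<close> at an integer order is the integral at that order.
\<close>

section \<open>Termwise integration and interchange of sums\<close>

text \<open>
Separate bounds \<open>h i\<close> keep the summability conditions among real functions, where the integrals are
Gamma values or powers.
\<close>

lemma set_integral_sums_dominated:
  fixes f :: "nat \<Rightarrow> 'a \<Rightarrow> 'b::{banach, second_countable_topology}"
  assumes A: "A \<in> sets M"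
    and f: "\<And>i. set_borel_measurable M A (f i)"
    and h: "\<And>i. set_integrable M A (h i)"
    and le: "\<And>i x. x \<in> A \<Longrightarrow> norm (f i x) \<le> h i x"
    and hs: "\<And>x. x \<in> A \<Longrightarrow> summable (\<lambda>i. h i x)"
    and hi: "summable (\<lambda>i. LINT x:A|M. h i x)"
    and g: "\<And>x. x \<in> A \<Longrightarrow> (\<lambda>i. f i x) sums g x"
  shows "set_integrable M A g"
    and "(\<lambda>i. LINT x:A|M. f i x) sums (LINT x:A|M. g x)"
proof -
  let ?f = "\<lambda>i x. indicator A x *\<^sub>R f i x"
  have fi: "set_integrable M A (f i)" for i
    by (rule set_integrable_bound[OF h[of i] f]) (use le in \<open>auto intro!: AE_I2 intro: order_trans[OF _ abs_ge_self]\<close>)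
  hence 1: "integrable M (?f i)" for i by (simp add: set_integrable_def)
  have hs': "summable (\<lambda>i. norm (f i x))" if "x \<in> A" for x
    by (rule summable_comparison_test'[OF hs[OF that], of 0]) (use le that in auto)
  have 2: "AE x in M. summable (\<lambda>i. norm (?f i x))"
    by (intro AE_I2) (use hs' in \<open>auto simp: indicator_def\<close>)
  have 3: "summable (\<lambda>i. LINT x|M. norm (?f i x))"
  proof (rule summable_comparison_test'[OF hi, of 0])
    fix i
    have "(LINT x|M. norm (?f i x)) \<le> (LINT x|M. indicator A x *\<^sub>R h i x)"
    proof (rule integral_mono)
      show "integrable M (\<lambda>x. norm (?f i x))" using 1 by (rule integrable_norm)
    qed (use h[of i] le in \<open>auto simp: indicator_def set_integrable_def\<close>)
    thus "norm (LINT x|M. norm (?f i x)) \<le> (LINT x:A|M. h i x)"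
      by (simp add: set_lebesgue_integral_def)
  qed
  have eq: "(\<lambda>x. \<Sum>i. ?f i x) = (\<lambda>x. indicator A x *\<^sub>R g x)"
    using g by (auto simp: indicator_def sums_iff fun_eq_iff)
  show "set_integrable M A g"
    using integrable_suminf[OF 1 2 3] eq by (simp add: set_integrable_def)
  show "(\<lambda>i. LINT x:A|M. f i x) sums (LINT x:A|M. g x)"
    using sums_integral[OF 1 2 3] eq by (simp add: set_lebesgue_integral_def)
qed

lemma set_borel_measurable_continuous:
  fixes f :: "real \<Rightarrow> 'a::{second_countable_topology,real_normed_vector}"
  assumes "A \<in> sets borel" "continuous_on A f"
  shows "set_borel_measurable lborel A f"
  using assms
  by (auto simp: set_borel_measurable_def intro: borel_measurable_continuous_on_indicator)

text \<open>
Change of variables lives on the completed measure, the termwise integrals on the Borel one; for Borel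
measurable integrands the two agree.
\<close>

lemma
  fixes f :: "real \<Rightarrow> 'a::euclidean_space"
  assumes "set_borel_measurable lborel S f"
  shows set_integrable_lebesgue_iff_lborel: "set_integrable lebesgue S f \<longleftrightarrow> set_integrable lborel S f"
    and set_integral_lebesgue_eq_lborel: "(LINT t:S|lebesgue. f t) = (LINT t:S|lborel. f t)"
  using assms
  by (auto simp: set_integrable_def set_lebesgue_integral_def set_borel_measurable_def
      integrable_completion integral_completion)

text \<open>
A product bound with summable factors makes the family absolutely summable over all pairs, so both
orders of summation give the unordered sum.
\<close>

lemma suminf_swap_dominated:
  fixes c :: "nat \<Rightarrow> nat \<Rightarrow> 'a::banach" and A B :: "nat \<Rightarrow> real"
  assumes le: "\<And>j k. norm (c j k) \<le> A j * B k"
    and A: "summable A" "\<And>j. A j \<ge> 0" and B: "summable B" "\<And>k. B k \<ge> 0"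
  shows "summable (\<lambda>j. \<Sum>k. c j k)" and "(\<Sum>j. \<Sum>k. c j k) = (\<Sum>k. \<Sum>j. c j k)"
proof -
  have row: "summable (\<lambda>k. norm (c j k))" for j
    by (rule summable_comparison_test'[OF summable_mult[OF B(1), of "A j"], of 0]) (use le in auto)
  have col: "summable (\<lambda>j. norm (c j k))" for k
    by (rule summable_comparison_test'[OF summable_mult2[OF A(1), of "B k"], of 0]) (use le in auto)
  have prod: "(\<lambda>(j, k). A j * B k) summable_on UNIV \<times> UNIV"
  proof (rule summable_on_SigmaI)
    show "((\<lambda>k. case (j, k) of (j, k) \<Rightarrow> A j * B k) has_sum (A j * suminf B)) UNIV" for j
    proof -
      have "(\<lambda>k. A j * B k) sums (A j * suminf B)"
        by (intro sums_mult summable_sums B)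
      thus ?thesis using A B by (auto intro!: sums_nonneg_imp_has_sum)
    qed
    show "(\<lambda>j. A j * suminf B) summable_on UNIV"
      using A B by (subst summable_on_UNIV_nonneg_real_iff) (auto intro!: summable_mult2 suminf_nonneg mult_nonneg_nonneg)
  qed (use A B in auto)
  have "(\<lambda>(j, k). c j k) summable_on UNIV \<times> UNIV"
    by (rule Infinite_Sum.abs_summable_summable, rule Infinite_Sum.abs_summable_on_comparison_test'[OF prod])
       (use le in auto)
  note sm = this
  have sw: "(\<Sum>\<^sub>\<infinity>j. \<Sum>\<^sub>\<infinity>k. c j k) = (\<Sum>\<^sub>\<infinity>k. \<Sum>\<^sub>\<infinity>j. c j k)"
    by (rule infsum_swap_banach) (use sm in auto)
  have r: "(\<Sum>\<^sub>\<infinity>k. c j k) = (\<Sum>k. c j k)" for j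
    using norm_summable_imp_has_sum[OF row[of j] summable_sums[OF summable_norm_cancel[OF row[of j]]]]
    by (simp add: infsumI)
  have cl: "(\<Sum>\<^sub>\<infinity>j. c j k) = (\<Sum>j. c j k)" for k
    using norm_summable_imp_has_sum[OF col[of k] summable_sums[OF summable_norm_cancel[OF col[of k]]]]
    by (simp add: infsumI)
  have o1: "summable (\<lambda>j. norm (\<Sum>k. c j k))"
  proof (rule summable_comparison_test')
    show "summable (\<lambda>j. A j * suminf B)" by (intro summable_mult2 A)
    fix j
    have "norm (\<Sum>k. c j k) \<le> (\<Sum>k. norm (c j k))" by (rule summable_norm[OF row])
    also have "\<dots> \<le> (\<Sum>k. A j * B k)" by (intro suminf_le row summable_mult B le)
    also have "\<dots> = A j * suminf B" by (rule suminf_mult[OF B(1)])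
    finally show "norm (norm (\<Sum>k. c j k)) \<le> A j * suminf B" by simp
  qed
  have o2: "summable (\<lambda>k. norm (\<Sum>j. c j k))"
  proof (rule summable_comparison_test')
    show "summable (\<lambda>k. suminf A * B k)" by (intro summable_mult B)
    fix k
    have "norm (\<Sum>j. c j k) \<le> (\<Sum>j. norm (c j k))" by (rule summable_norm[OF col])
    also have "\<dots> \<le> (\<Sum>j. A j * B k)" by (intro suminf_le col summable_mult2 A le)
    also have "\<dots> = suminf A * B k" by (rule suminf_mult2[OF A(1), symmetric])
    finally show "norm (norm (\<Sum>j. c j k)) \<le> suminf A * B k" by simp
  qed
  show "summable (\<lambda>j. \<Sum>k. c j k)" by (rule summable_norm_cancel[OF o1])
  have "(\<Sum>j. \<Sum>k. c j k) = (\<Sum>\<^sub>\<infinity>j. \<Sum>k. c j k)"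
    using norm_summable_imp_has_sum[OF o1 summable_sums[OF summable_norm_cancel[OF o1]]]
    by (simp add: infsumI)
  moreover have "(\<Sum>k. \<Sum>j. c j k) = (\<Sum>\<^sub>\<infinity>k. \<Sum>j. c j k)"
    using norm_summable_imp_has_sum[OF o2 summable_sums[OF summable_norm_cancel[OF o2]]]
    by (simp add: infsumI)
  ultimately show "(\<Sum>j. \<Sum>k. c j k) = (\<Sum>k. \<Sum>j. c j k)"
    using sw by (simp only: r cl)
qed

section \<open>The Gamma integral with a complex scale\<close>

lemma has_bochner_integral_Gamma_scaled:
  fixes s b :: real
  assumes "s > 0" "b > 0"
  shows "has_bochner_integral lborel (\<lambda>t. indicator {0<..} t *\<^sub>R (t powr (s - 1) * exp (- b * t)))
           (Gamma s / b powr s)"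
proof -
  let ?f = "\<lambda>t::real. indicator {0..} t * t powr (s - 1) / exp t"
  have "has_bochner_integral lborel ?f (Gamma s)"
  proof (rule has_bochner_integral_nn_integral)
    show "(\<integral>\<^sup>+x. ennreal (?f x) \<partial>lborel) = ennreal (Gamma s)"
      using Gamma_conv_nn_integral_real[OF assms(1)] by simp
    show "0 \<le> Gamma s" using assms Gamma_real_pos by (simp add: less_imp_le)
  qed auto
  hence "has_bochner_integral lborel (\<lambda>t. ?f (0 + b * t)) (Gamma s /\<^sub>R \<bar>b\<bar>)"
    using assms by (subst (asm) lborel_has_bochner_integral_real_affine_iff[of b _ _ 0]) auto
  hence "has_bochner_integral lborel (\<lambda>t. b powr (1 - s) * ?f (0 + b * t)) (b powr (1 - s) * (Gamma s /\<^sub>R \<bar>b\<bar>))"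
    by (intro has_bochner_integral_mult_right) auto
  also have "(\<lambda>t. b powr (1 - s) * ?f (0 + b * t)) =
      (\<lambda>t. indicator {0<..} t *\<^sub>R (t powr (s - 1) * exp (- b * t)))"
  proof
    fix t :: real
    consider "t > 0" | "t = 0" | "t < 0" by linarith
    thus "b powr (1 - s) * ?f (0 + b * t) = indicator {0<..} t *\<^sub>R (t powr (s - 1) * exp (- b * t))"
      using assms
      by cases (auto simp: indicator_def powr_mult powr_diff exp_minus field_simps zero_le_mult_iff mult_less_0_iff)
  qed
  also have "b powr (1 - s) * (Gamma s /\<^sub>R \<bar>b\<bar>) = Gamma s / b powr s"
    using assms by (simp add: powr_diff field_simps)
  finally show ?thesis .
qed

lemma
  fixes s b :: real
  assumes "s > 0" "b > 0"
  shows set_integrable_Gamma_scaled: "set_integrable lborel {0<..} (\<lambda>t. t powr (s - 1) * exp (- b * t))"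
    and set_integral_Gamma_scaled: "(LINT t:{0<..}|lborel. t powr (s - 1) * exp (- b * t)) = Gamma s / b powr s"
  using has_bochner_integral_Gamma_scaled[OF assms]
  by (auto simp: set_integrable_def set_lebesgue_integral_def has_bochner_integral_iff)

text \<open>
The discs centred at \<open>b > 0\<close> with radius \<open>b\<close> exhaust the right half-plane as \<open>b\<close> grows. Such a disc
is where the binomial series around \<open>b\<close> converges.
\<close>

lemma ex_real_disc_contains:
  fixes a :: complex
  assumes "Re a > 0"
  obtains b :: real where "b > 0" "cmod (a - of_real b) < b"
proof -
  \<comment> \<open>\<open>a\<close> lies in the disc as soon as \<open>2 b Re a\<close> exceeds the square of its modulus.\<close>
  define b where "b = (cmod a)\<^sup>2 / Re a"
  have "a \<noteq> 0" using assms by auto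
  hence b: "b > 0" using assms by (simp add: b_def)
  have "(cmod (a - of_real b))\<^sup>2 = (cmod a)\<^sup>2 - 2 * b * Re a + b\<^sup>2"
    by (simp only: cmod_power2) (simp add: power2_eq_square algebra_simps)
  also have "\<dots> < b\<^sup>2" using assms \<open>a \<noteq> 0\<close> by (simp add: b_def)
  finally have "cmod (a - of_real b) < b" using b by (simp add: power2_less_imp_less)
  with b that show ?thesis by blast
qed

lemma sums_pochhammer_binomial:
  fixes s z :: complex
  assumes "norm z < 1"
  shows "(\<lambda>k. pochhammer s k / fact k * z ^ k) sums (1 - z) powr (- s)"
proof -
  have "(\<lambda>n. ((- s) gchoose n) * (- z) ^ n) sums (1 + (- z)) powr (- s)"
    using assms by (intro gen_binomial_complex) auto
  also have "(\<lambda>n. ((- s) gchoose n) * (- z) ^ n) = (\<lambda>k. pochhammer s k / fact k * z ^ k)"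
  proof
    fix k
    have "(- 1) ^ k * (- z) ^ k = z ^ k"
      by (subst power_mult_distrib[symmetric]) simp
    thus "((- s) gchoose k) * (- z) ^ k = pochhammer s k / fact k * z ^ k"
      by (simp add: gbinomial_pochhammer)
  qed
  finally show ?thesis by simp
qed

text \<open>
Rotating the path of integration is avoided: with \<open>a\<close> in the disc around a real \<open>b\<close>, the factor
\<open>exp ((b - a) t)\<close> is expanded against the real weight \<open>exp (- b t)\<close>. The terms are real Gamma integrals
of orders \<open>s + k\<close>, and they add up to the binomial series of \<open>(a / b)\<close> raised to \<open>- s\<close>.
\<close>

lemma Gamma_integral_complex_scaled:
  fixes s :: real and a :: complex
  assumes s: "s > 0" and a: "Re a > 0"
  shows "set_integrable lborel {0<..} (\<lambda>t. of_real (t powr (s - 1)) * exp (- a * of_real t))"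
    and "(LINT t:{0<..}|lborel. of_real (t powr (s - 1)) * exp (- a * of_real t)) =
           of_real (Gamma s) * a powr (- of_real s)"
proof -
  obtain b :: real where b: "b > 0" "cmod (a - of_real b) < b"
    using ex_real_disc_contains[OF a] .
  \<comment> \<open>The expansion variable; \<open>b z = b - a\<close> is the coefficient of \<open>t\<close> in the expanded exponential.\<close>
  define z where "z = 1 - a / of_real b"
  have z: "norm z < 1"
  proof -
    have "z = (of_real b - a) / of_real b" using b by (simp add: z_def field_simps)
    thus ?thesis using b by (simp add: norm_divide norm_minus_commute)
  qed
  have bz: "of_real b - a = of_real b * z" using b by (simp add: z_def field_simps)
  define f where "f = (\<lambda>k t. (of_real b * z) ^ k / fact k * complex_of_real (t powr (s + real k - 1) * exp (- b * t)))"
  define h where "h = (\<lambda>k t. (b * norm z) ^ k / fact k * (t powr (s + real k - 1) * exp (- b * t)))"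
  have int: "set_integrable lborel {0<..} (\<lambda>t. t powr (s + real k - 1) * exp (- b * t))" for k
    using set_integrable_Gamma_scaled[of "s + real k" b] s b by (simp add: add_pos_nonneg)
  have intv: "(LINT t:{0<..}|lborel. t powr (s + real k - 1) * exp (- b * t)) = Gamma s * pochhammer s k / b ^ k / b powr s" for k
  proof -
    have "s \<notin> \<int>\<^sub>\<le>\<^sub>0" using s nonpos_Ints_nonpos by force
    hence "pochhammer s k = Gamma (s + real k) / Gamma s" by (rule pochhammer_Gamma)
    moreover have "Gamma s \<noteq> 0" using Gamma_real_pos[OF s] by simp
    ultimately show ?thesis
      using set_integral_Gamma_scaled[of "s + real k" b] s b
      by (simp add: add_pos_nonneg powr_add powr_realpow field_simps)
  qed
  have le: "norm (f k t) = h k t" for k t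
    using b by (simp add: f_def h_def norm_mult norm_divide norm_power abs_mult)
  have eq: "of_real (t powr (s - 1)) * exp (- a * of_real t) =
       of_real (t powr (s - 1) * exp (- b * t)) * exp (of_real b * z * of_real t)" if "t > 0" for t
  proof -
    have "- a * of_real t = of_real (- b * t) + of_real b * z * of_real t"
      by (simp only: bz[symmetric]) (simp add: algebra_simps)
    hence "exp (- a * of_real t) = of_real (exp (- b * t)) * exp (of_real b * z * of_real t)"
      by (simp only: exp_add exp_of_real)
    thus ?thesis by simp
  qed
  have pw: "t powr (s + real k - 1) = t powr (s - 1) * t ^ k" if "t > 0" for t k
    using that by (simp add: powr_add powr_diff powr_realpow)
  have "continuous_on {0<..} (f k)" for k
    unfolding f_def by (intro continuous_intros) auto
  hence fm: "set_borel_measurable lborel {0<..} (f k)" for k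
    by (intro set_borel_measurable_continuous) auto
  have hint: "set_integrable lborel {0<..} (h k)" for k
    unfolding h_def by (intro set_integrable_mult_right int)
  have hsum: "summable (\<lambda>k. h k t)" if "t \<in> {0<..}" for t
  proof -
    have "summable (\<lambda>k. t powr (s - 1) * exp (- b * t) * ((b * norm z * t) ^ k /\<^sub>R fact k))"
      by (intro summable_mult summable_exp_generic)
    thus ?thesis using that
      by (simp add: h_def pw power_mult_distrib field_simps)
  qed
  have hval: "summable (\<lambda>k. LINT t:{0<..}|lborel. h k t)"
  proof -
    have "summable (\<lambda>k. of_real (norm z) ^ k * pochhammer (complex_of_real s) k / fact k)"
      using sums_pochhammer_binomial[of "of_real (norm z)" "of_real s"] z 
      by (auto simp: sums_iff mult_ac)
    hence "summable (\<lambda>k. complex_of_real (norm z ^ k * pochhammer s k / fact k))"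
      by (simp add: pochhammer_of_real)
    hence "summable (\<lambda>k. (norm z ^ k * pochhammer s k / fact k))"
      by (subst (asm) summable_of_real_iff)
    hence "summable (\<lambda>k. Gamma s / b powr s * (norm z ^ k * pochhammer s k / fact k))"
      by (rule summable_mult)
    also have "(\<lambda>k. Gamma s / b powr s * (norm z ^ k * pochhammer s k / fact k)) = (\<lambda>k. LINT t:{0<..}|lborel. h k t)"
    proof
      fix k
      have "(LINT t:{0<..}|lborel. h k t) = (b * norm z) ^ k / fact k * (Gamma s * pochhammer s k / b ^ k / b powr s)"
        unfolding h_def set_integral_mult_right intv ..
      thus "Gamma s / b powr s * (norm z ^ k * pochhammer s k / fact k) = (LINT t:{0<..}|lborel. h k t)"
        using b by (simp add: power_mult_distrib mult_ac)
    qed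
    finally show ?thesis .
  qed
  have fs: "(\<lambda>k. f k t) sums (of_real (t powr (s - 1)) * exp (- a * of_real t))" if "t \<in> {0<..}" for t
  proof -
    have "(\<lambda>k. of_real (t powr (s - 1) * exp (- b * t)) * ((of_real b * z * of_real t) ^ k /\<^sub>R fact k)) sums
       (of_real (t powr (s - 1) * exp (- b * t)) * exp (of_real b * z * of_real t))"
      by (intro sums_mult exp_converges)
    also have "(\<lambda>k. of_real (t powr (s - 1) * exp (- b * t)) * ((of_real b * z * of_real t) ^ k /\<^sub>R fact k)) = (\<lambda>k. f k t)"
      using that by (simp add: f_def pw power_mult_distrib scaleR_conv_of_real field_simps)
    finally show ?thesis using that by (simp only: eq greaterThan_iff)
  qed
  note * = set_integral_sums_dominated[of _ lborel f h, OF _ fm hint _ hsum hval fs]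
  show "set_integrable lborel {0<..} (\<lambda>t. of_real (t powr (s - 1)) * exp (- a * of_real t))"
    by (rule *(1)) (auto simp: le)
  have "(\<lambda>k. LINT t:{0<..}|lborel. f k t) sums (LINT t:{0<..}|lborel. of_real (t powr (s - 1)) * exp (- a * of_real t))"
    by (rule *(2)) (auto simp: le)
  moreover have "(LINT t:{0<..}|lborel. f k t) =
      of_real (Gamma s / b powr s) * (pochhammer (of_real s) k / fact k * z ^ k)" for k
  proof -
    have "(LINT t:{0<..}|lborel. f k t) =
        (of_real b * z) ^ k / fact k * of_real (Gamma s * pochhammer s k / b ^ k / b powr s)"
      unfolding f_def set_integral_mult_right set_integral_complex_of_real intv ..
    thus ?thesis using b by (simp add: power_mult_distrib pochhammer_of_real mult_ac)
  qed
  moreover have "(\<lambda>k. of_real (Gamma s / b powr s) * (pochhammer (of_real s) k / fact k * z ^ k)) sums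
      (of_real (Gamma s / b powr s) * (1 - z) powr (- of_real s))"
    by (intro sums_mult sums_pochhammer_binomial z)
  ultimately have "(LINT t:{0<..}|lborel. of_real (t powr (s - 1)) * exp (- a * of_real t)) =
      of_real (Gamma s / b powr s) * (1 - z) powr (- of_real s)"
    by (simp add: sums_unique2)
  also have "1 - z = a / of_real b" by (simp add: z_def)
  also have "(a / of_real b) powr (- of_real s) = a powr (- of_real s) * of_real (b powr s)"
  proof -
    have "a = of_real b * (a / of_real b)" using b by simp
    hence "a powr (- of_real s) = of_real b powr (- of_real s) * (a / of_real b) powr (- of_real s)"
      using powr_times_real_left[of "of_real b" "a / of_real b" "- of_real s"] b by (metis Reals_of_real Re_complex_of_real less_imp_le)
    also have "of_real b powr (- of_real s) = complex_of_real (b powr (-s))"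
      using b by (simp add: powr_of_real[symmetric])
    finally show ?thesis using b by (simp add: powr_minus field_simps)
  qed
  finally show "(LINT t:{0<..}|lborel. of_real (t powr (s - 1)) * exp (- a * of_real t)) =
           of_real (Gamma s) * a powr (- of_real s)"
    using b by (simp add: field_simps)
qed

section \<open>The incomplete Gamma function of non-integer order\<close>

definition upper_Gamma_integral :: "real \<Rightarrow> complex \<Rightarrow> complex" where
  "upper_Gamma_integral s a = (LINT t:{1<..}|lborel. of_real (t powr (s - 1)) * exp (- a * of_real t))"

text \<open>
The lower incomplete Gamma function without its factor \<open>a\<^sup>s\<close>, as a series that keeps its meaning at
negative non-integer orders, where the integral over \<open>{0<..1}\<close> diverges.
\<close>

definition lower_Gamma_series :: "real \<Rightarrow> complex \<Rightarrow> complex" where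
  "lower_Gamma_series s a = (\<Sum>j. (- a) ^ j / (fact j * of_real (s + real j)))"

lemma
  fixes u :: real
  assumes "u > 0"
  shows set_integrable_powr_unit: "set_integrable lborel {0<..1} (\<lambda>t. t powr (u - 1))"
    and set_integral_powr_unit: "(LINT t:{0<..1}|lborel. t powr (u - 1)) = 1 / u"
proof -
  have *: "((\<lambda>t. t powr (u - 1)) has_integral 1 / u) {0..1}"
    using has_integral_powr_from_0[of "u - 1" 1] assms by simp
  hence *: "((\<lambda>t. t powr (u - 1)) has_integral 1 / u) {0<..1}"
    by (subst has_integral_spike_set_eq[of _ "{0..1}"])
       (auto intro!: negligible_subset[of "{0}" "{x. _ x}"])
  have m: "set_borel_measurable lborel {0<..1} (\<lambda>t. t powr (u - 1))"
    by (intro set_borel_measurable_continuous continuous_intros) auto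
  have "(\<lambda>t. t powr (u - 1)) absolutely_integrable_on {0<..1}"
    using * by (intro nonnegative_absolutely_integrable_1) (auto simp: integrable_on_def)
  thus 1: "set_integrable lborel {0<..1} (\<lambda>t. t powr (u - 1))"
    using set_integrable_lebesgue_iff_lborel[OF m] by simp
  show "(LINT t:{0<..1}|lborel. t powr (u - 1)) = 1 / u"
    using set_borel_integral_eq_integral(2)[OF 1] * by (simp add: integral_unique)
qed

text \<open>
A common lower bound for all denominators \<open>s + j\<close> and \<open>s - j + k\<close> of the series below.
\<close>

lemma dist_Ints_bound:
  fixes s :: real
  assumes "s \<notin> \<int>"
  obtains d where "d > 0" "\<And>m::int. d \<le> \<bar>s + of_int m\<bar>"
proof -
  define d where "d = min (frac s) (1 - frac s)"
  have "d > 0" using assms frac_lt_1[of s] frac_gt_0_iff[of s] by (auto simp: d_def)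
  moreover have "d \<le> \<bar>s + of_int m\<bar>" for m :: int
  proof -
    define k where "k = \<lfloor>s\<rfloor> + m"
    have eq: "s + of_int m = frac s + of_int k" by (simp add: frac_def k_def)
    show ?thesis
    proof (cases "k \<ge> 0")
      case True
      hence "real_of_int k \<ge> 0" by simp
      thus ?thesis unfolding eq d_def using frac_ge_0[of s] by linarith
    next
      case False
      hence "k \<le> -1" by simp
      hence "real_of_int k \<le> -1" by linarith
      thus ?thesis unfolding eq d_def using frac_lt_1[of s] by linarith
    qed
  qed
  ultimately show ?thesis using that by blast
qed

lemma lower_Gamma_series_sums:
  assumes "s \<notin> \<int>"
  shows "(\<lambda>j. (- a) ^ j / (fact j * of_real (s + real j))) sums lower_Gamma_series s a"
proof -
  obtain d where d: "d > 0" "\<And>m::int. d \<le> \<bar>s + of_int m\<bar>" using dist_Ints_bound[OF assms] by blast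
  have "summable (\<lambda>j. (- a) ^ j / (fact j * complex_of_real (s + real j)))"
  proof (rule summable_comparison_test')
    show "summable (\<lambda>j. (1 / d) * (norm a ^ j /\<^sub>R fact j))"
      by (intro summable_mult summable_exp_generic)
    fix j :: nat assume "j \<ge> 0"
    have dj: "d \<le> \<bar>s + real j\<bar>" using d(2)[of "int j"] by simp
    hence "1 / \<bar>s + real j\<bar> \<le> 1 / d" using d(1) by (intro divide_left_mono) auto
    hence "(norm a ^ j / fact j) * (1 / \<bar>s + real j\<bar>) \<le> (norm a ^ j / fact j) * (1 / d)"
      by (intro mult_left_mono) auto
    thus "norm ((- a) ^ j / (fact j * complex_of_real (s + real j))) \<le> (1 / d) * (norm a ^ j /\<^sub>R fact j)"
      by (simp only: norm_mult norm_divide norm_power norm_minus_cancel norm_of_real norm_fact)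
         (simp add: field_simps)
  qed
  thus ?thesis unfolding lower_Gamma_series_def by (rule summable_sums)
qed

lemma lower_Gamma_integral:
  fixes s :: real and a :: complex
  assumes s: "s > 0"
  shows "set_integrable lborel {0<..1} (\<lambda>t. of_real (t powr (s - 1)) * exp (- a * of_real t))"
    and "(LINT t:{0<..1}|lborel. of_real (t powr (s - 1)) * exp (- a * of_real t)) = lower_Gamma_series s a"
proof -
  define f where "f = (\<lambda>k t. (- a) ^ k / fact k * complex_of_real (t powr (s + real k - 1)))"
  define h where "h = (\<lambda>k t. norm a ^ k / fact k * (t powr (s + real k - 1)))"
  have int: "set_integrable lborel {0<..1} (\<lambda>t. t powr (s + real k - 1))" for k
    using set_integrable_powr_unit[of "s + real k"] s by (simp add: add_pos_nonneg)
  have intv: "(LINT t:{0<..1}|lborel. t powr (s + real k - 1)) = 1 / (s + real k)" for k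
    using set_integral_powr_unit[of "s + real k"] s by (simp add: add_pos_nonneg)
  have le: "norm (f k t) = h k t" for k t
    by (simp add: f_def h_def norm_mult norm_divide norm_power abs_mult)
  have pw: "t powr (s + real k - 1) = t powr (s - 1) * t ^ k" if "t > 0" for t k
    using that by (simp add: powr_add powr_diff powr_realpow)
  have "continuous_on {0<..1} (f k)" for k
    unfolding f_def by (intro continuous_intros) auto
  hence fm: "set_borel_measurable lborel {0<..1} (f k)" for k
    by (intro set_borel_measurable_continuous) auto
  have hint: "set_integrable lborel {0<..1} (h k)" for k
    unfolding h_def by (intro set_integrable_mult_right int)
  have hsum: "summable (\<lambda>k. h k t)" if "t \<in> {0<..1}" for t
  proof -
    have "summable (\<lambda>k. t powr (s - 1) * ((norm a * t) ^ k /\<^sub>R fact k))"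
      by (intro summable_mult summable_exp_generic)
    thus ?thesis using that
      by (simp add: h_def pw power_mult_distrib field_simps)
  qed
  have hval: "summable (\<lambda>k. LINT t:{0<..1}|lborel. h k t)"
  proof (rule summable_comparison_test')
    show "summable (\<lambda>j. (1 / s) * (norm a ^ j /\<^sub>R fact j))"
      by (intro summable_mult summable_exp_generic)
    fix k :: nat
    have "(LINT t:{0<..1}|lborel. h k t) = norm a ^ k / fact k * (1 / (s + real k))"
      unfolding h_def set_integral_mult_right intv ..
    also have "\<dots> \<le> norm a ^ k / fact k * (1 / s)"
      using s by (intro mult_left_mono divide_left_mono) auto
    finally show "norm (LINT t:{0<..1}|lborel. h k t) \<le> (1 / s) * (norm a ^ k /\<^sub>R fact k)"
      using s unfolding h_def set_integral_mult_right intv by (simp add: divide_inverse mult_ac)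
  qed
  have fs: "(\<lambda>k. f k t) sums (of_real (t powr (s - 1)) * exp (- a * of_real t))" if "t \<in> {0<..1}" for t
  proof -
    have "(\<lambda>k. of_real (t powr (s - 1)) * ((- a * of_real t) ^ k /\<^sub>R fact k)) sums
       (of_real (t powr (s - 1)) * exp (- a * of_real t))"
      by (intro sums_mult exp_converges)
    also have "(\<lambda>k. of_real (t powr (s - 1)) * ((- a * of_real t) ^ k /\<^sub>R fact k)) = (\<lambda>k. f k t)"
      using that by (intro ext) (simp only: f_def pw power_mult_distrib scaleR_conv_of_real greaterThanAtMost_iff,
          simp add: field_simps)
    finally show ?thesis .
  qed
  note * = set_integral_sums_dominated[of _ lborel f h, OF _ fm hint _ hsum hval fs]
  show "set_integrable lborel {0<..1} (\<lambda>t. of_real (t powr (s - 1)) * exp (- a * of_real t))"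
    by (rule *(1)) (auto simp: le)
  have "(\<lambda>k. LINT t:{0<..1}|lborel. f k t) sums (LINT t:{0<..1}|lborel. of_real (t powr (s - 1)) * exp (- a * of_real t))"
    by (rule *(2)) (auto simp: le)
  moreover have "(LINT t:{0<..1}|lborel. f k t) = (- a) ^ k / (fact k * of_real (s + real k))" for k
  proof -
    have "(LINT t:{0<..1}|lborel. f k t) = (- a) ^ k / fact k * of_real (1 / (s + real k))"
      unfolding f_def set_integral_mult_right set_integral_complex_of_real intv ..
    thus ?thesis by simp
  qed
  ultimately show "(LINT t:{0<..1}|lborel. of_real (t powr (s - 1)) * exp (- a * of_real t)) = lower_Gamma_series s a"
    by (simp add: lower_Gamma_series_def sums_iff)
qed

lemma upper_Gamma_integrable_real:
  fixes s b :: real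
  assumes "b > 0"
  shows "set_integrable lborel {1<..} (\<lambda>t. t powr (s - 1) * exp (- b * t))"
proof (rule set_integrable_bound)
  define u where "u = max s 1"
  show "set_integrable lborel {1<..} (\<lambda>t. t powr (u - 1) * exp (- b * t))"
    by (rule set_integrable_subset[OF set_integrable_Gamma_scaled[of u b]]) (use assms in \<open>auto simp: u_def\<close>)
  show "set_borel_measurable lborel {1<..} (\<lambda>t. t powr (s - 1) * exp (- b * t))"
    by (intro set_borel_measurable_continuous continuous_intros) auto
  show "AE t in lborel. t \<in> {1<..} \<longrightarrow> norm (t powr (s - 1) * exp (- b * t)) \<le> norm (t powr (u - 1) * exp (- b * t))"
    by (intro AE_I2) (auto simp: abs_mult u_def intro!: powr_mono)
qed

lemma upper_Gamma_integrable:
  fixes s :: real and a :: complex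
  assumes "Re a > 0"
  shows "set_integrable lborel {1<..} (\<lambda>t. of_real (t powr (s - 1)) * exp (- a * of_real t))"
proof (rule set_integrable_bound[OF upper_Gamma_integrable_real[OF assms, of s]])
  show "set_borel_measurable lborel {1<..} (\<lambda>t. of_real (t powr (s - 1)) * exp (- a * of_real t))"
    by (intro set_borel_measurable_continuous continuous_intros) auto
qed (auto simp: norm_mult)

text \<open>
Integration by parts. Together with the matching recurrence of the series it continues the
evaluation of the upper integral to negative orders.
\<close>

lemma upper_Gamma_integral_plus1:
  fixes s :: real and a :: complex
  assumes a: "Re a > 0"
  shows "of_real s * upper_Gamma_integral s a = a * upper_Gamma_integral (s + 1) a - exp (- a)"
proof -
  \<comment> \<open>\<open>F\<close> is an antiderivative of \<open>f\<close>; it vanishes at infinity and is \<open>exp (- a)\<close> at 1.\<close>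
  define F where "F = (\<lambda>t::real. complex_of_real (t powr s) * exp (- a * of_real t))"
  define f1 where "f1 = (\<lambda>t::real. complex_of_real (t powr (s - 1)) * exp (- a * of_real t))"
  define f where "f = (\<lambda>t. of_real s * f1 t - a * F t)"
  have i1: "set_integrable lborel {1<..} f1" unfolding f1_def by (rule upper_Gamma_integrable[OF a])
  have i2: "set_integrable lborel {1<..} F" unfolding F_def using upper_Gamma_integrable[OF a, of "s + 1"] by simp
  have if': "set_integrable lborel {1<..} f"
    unfolding f_def by (intro set_integral_diff set_integrable_mult_right i1 i2)
  have ein: "einterval 1 \<infinity> = {1<..}" by (auto simp: einterval_def one_ereal_def)
  have "(LBINT t=1..\<infinity>. f t) = 0 - F 1"
  proof (rule interval_integral_FTC_integrable[where F = F])
    fix x :: real assume "1 < ereal x"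
    hence x: "x > 1" by (simp add: one_ereal_def)
    have "((\<lambda>t. t powr s) has_real_derivative s * x powr (s - 1)) (at x)"
      using x by (auto intro!: derivative_eq_intros)
    hence d1: "((\<lambda>t. complex_of_real (t powr s)) has_vector_derivative of_real (s * x powr (s - 1))) (at x)"
      by (intro has_vector_derivative_of_real) (simp add: has_real_derivative_iff_has_vector_derivative)
    have d2: "((\<lambda>t. exp (- a * of_real t)) has_vector_derivative (- a * exp (- a * of_real x))) (at x)"
      by (rule has_vector_derivative_real_field) (auto intro!: derivative_eq_intros)
    show "(F has_vector_derivative f x) (at x)"
      unfolding F_def
      by (rule has_vector_derivative_eq_rhs[OF has_vector_derivative_mult[OF d1 d2]])
         (simp add: f_def f1_def F_def algebra_simps)
    show "isCont f x" unfolding f_def f1_def F_def using x by (intro continuous_intros) auto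
  next
    show "set_integrable lborel (einterval 1 \<infinity>) f" using if' by (simp add: ein)
    have "isCont F 1" unfolding F_def by (intro continuous_intros) auto
    hence "(F \<longlongrightarrow> F 1) (at_right 1)" by (auto simp: isCont_def intro: filterlim_mono[OF _ order_refl at_le])
    thus "((F \<circ> real_of_ereal) \<longlongrightarrow> F 1) (at_right 1)"
      unfolding one_ereal_def by (simp only: ereal_tendsto_simps)
    have "((\<lambda>t. t powr s * exp (- Re a * t)) \<longlongrightarrow> 0) at_top" using a by real_asymp
    hence "(F \<longlongrightarrow> 0) at_top"
      by (rule Lim_null_comparison[rotated]) (simp add: F_def norm_mult)
    thus "((F \<circ> real_of_ereal) \<longlongrightarrow> 0) (at_left \<infinity>)"
      by (simp only: ereal_tendsto_simps)
  qed simp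
  also have "(LBINT t=1..\<infinity>. f t) = (LINT t:{1<..}|lborel. f t)"
    using interval_integral_to_infinity_eq[where a = 1 and f = f] by (simp add: one_ereal_def)
  also have "\<dots> = of_real s * (LINT t:{1<..}|lborel. f1 t) - a * (LINT t:{1<..}|lborel. F t)"
    unfolding f_def by (subst set_integral_diff) (auto intro!: set_integrable_mult_right i1 i2)
  finally show ?thesis
    by (simp add: upper_Gamma_integral_def f1_def F_def algebra_simps)
qed

text \<open>
Writing \<open>s / (s + j) = 1 - j / (s + j)\<close> splits the series into the exponential series and a series
whose term for \<open>j = 0\<close> vanishes; shifting the latter by one gives order \<open>s + 1\<close>.
\<close>

lemma lower_Gamma_series_plus1:
  assumes s: "s \<notin> \<int>"
  shows "of_real s * lower_Gamma_series s a = a * lower_Gamma_series (s + 1) a + exp (- a)"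
proof -
  have s1: "s + 1 \<notin> \<int>" using s by (metis Ints_1 Ints_diff add_diff_cancel_right')
  have nz: "complex_of_real (s + real j) \<noteq> 0" for j
  proof
    assume "complex_of_real (s + real j) = 0"
    hence "s + real j = 0" by (simp only: of_real_eq_0_iff)
    hence "s = of_int (- int j)" by simp
    thus False using s Ints_of_int by metis
  qed
  define g where "g = (\<lambda>j. (- a) ^ j / fact j * (of_nat j / complex_of_real (s + real j)))"
  have "(\<lambda>j. - a * ((- a) ^ j / (fact j * of_real (s + 1 + real j)))) sums (- a * lower_Gamma_series (s + 1) a)"
    by (intro sums_mult lower_Gamma_series_sums s1)
  also have "(\<lambda>j. - a * ((- a) ^ j / (fact j * of_real (s + 1 + real j)))) = (\<lambda>j. g (Suc j))"
  proof
    fix j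
    have "complex_of_real (s + real (Suc j)) = of_real (s + 1 + real j)" by simp
    hence "g (Suc j) = (- a) ^ Suc j / (of_nat (Suc j) * fact j) * (of_nat (Suc j) / of_real (s + 1 + real j))"
      by (simp add: g_def)
    also have "\<dots> = - a * ((- a) ^ j / (fact j * of_real (s + 1 + real j)))"
      by (simp del: of_nat_Suc)
    finally show "- a * ((- a) ^ j / (fact j * of_real (s + 1 + real j))) = g (Suc j)" ..
  qed
  finally have "g sums (- a * lower_Gamma_series (s + 1) a)"
    by (subst (asm) sums_Suc_iff) (simp add: g_def)
  hence "(\<lambda>j. (- a) ^ j /\<^sub>R fact j - g j) sums (exp (- a) - (- a * lower_Gamma_series (s + 1) a))"
    by (intro sums_diff exp_converges)
  also have "(\<lambda>j. (- a) ^ j /\<^sub>R fact j - g j) = (\<lambda>j. of_real s * ((- a) ^ j / (fact j * of_real (s + real j))))"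
  proof
    fix j
    have "u / of_nat (fact j) - u / of_nat (fact j) * (n / z) = (z - n) * (u / (of_nat (fact j) * z))"
      if "z \<noteq> 0" for u n z :: complex
      using that by (simp add: field_simps)
    from this[OF nz[of j], of "(- a) ^ j" "of_nat j"]
    show "(- a) ^ j /\<^sub>R fact j - g j = of_real s * ((- a) ^ j / (fact j * of_real (s + real j)))"
      by (simp add: g_def scaleR_conv_of_real divide_inverse mult_ac)
  qed
  finally have "(\<lambda>j. of_real s * ((- a) ^ j / (fact j * of_real (s + real j)))) sums
     (exp (- a) - (- a * lower_Gamma_series (s + 1) a))" .
  moreover have "(\<lambda>j. of_real s * ((- a) ^ j / (fact j * of_real (s + real j)))) sums (of_real s * lower_Gamma_series s a)"
    by (intro sums_mult lower_Gamma_series_sums s)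
  ultimately show ?thesis by (auto dest: sums_unique2)
qed

text \<open>
For positive orders this is the Gamma integral minus its part over \<open>{0<..1}\<close>. Both sides satisfy the same
recurrence in \<open>s\<close>, which reaches every other non-integer order downwards.
\<close>

theorem upper_Gamma_integral_eq:
  fixes s :: real and a :: complex
  assumes a: "Re a > 0" and s: "s \<notin> \<int>"
  shows "upper_Gamma_integral s a = of_real (Gamma s) * a powr (- of_real s) - lower_Gamma_series s a"
proof -
  have "upper_Gamma_integral s a = of_real (Gamma s) * a powr (- of_real s) - lower_Gamma_series s a"
    if "s \<notin> \<int>" "s + real n > 0" for n s
    using that
  proof (induction n arbitrary: s)
    case 0
    hence s: "s > 0" by simp
    have "{0<..} = {0<..1} \<union> {(1::real)<..}" by auto
    hence "of_real (Gamma s) * a powr (- of_real s) = lower_Gamma_series s a + upper_Gamma_integral s a"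
      using Gamma_integral_complex_scaled(2)[OF s a] lower_Gamma_integral[OF s, of a] upper_Gamma_integrable[OF a, of s]
      by (simp only: \<open>{0<..} = {0<..1} \<union> {(1::real)<..}\<close>)
         (subst (asm) set_integral_Un, auto simp: upper_Gamma_integral_def)
    thus ?case by (simp add: algebra_simps)
  next
    case (Suc n)
    have s1: "s + 1 \<notin> \<int>" using Suc.prems by (metis Ints_1 Ints_diff add_diff_cancel_right')
    have s0: "s \<noteq> 0" using Suc.prems by auto
    have a0: "a \<noteq> 0" using a by auto
    have "upper_Gamma_integral (s + 1) a = of_real (Gamma (s + 1)) * a powr (- of_real (s + 1)) - lower_Gamma_series (s + 1) a"
      using Suc.IH[of "s + 1"] Suc.prems s1 by (simp add: algebra_simps)
    also have "Gamma (s + 1) = s * Gamma s"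
      using Suc.prems by (intro Gamma_plus1) (auto dest: nonpos_Ints_Int)
    also have "a powr (- of_real (s + 1)) = a powr (- of_real s) / a"
      using a0 by (simp add: powr_diff)
    finally have "a * upper_Gamma_integral (s + 1) a = of_real s * (of_real (Gamma s) * a powr (- of_real s)) - a * lower_Gamma_series (s + 1) a"
      using a0 by (simp add: field_simps)
    hence "of_real s * upper_Gamma_integral s a = of_real s * (of_real (Gamma s) * a powr (- of_real s) - lower_Gamma_series s a)"
      using upper_Gamma_integral_plus1[OF a, of s] lower_Gamma_series_plus1[OF Suc.prems(1), of a]
      unfolding right_diff_distrib by simp
    thus ?case using s0 by simp
  qed
  \<comment> \<open>\<open>n\<close> counts the downward steps from a positive order.\<close>
  from this[of s "nat \<lceil>1 - s\<rceil>"] s show ?thesis by linarith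
qed

section \<open>Splitting the Macdonald integral\<close>

definition upper_Macdonald_integral :: "real \<Rightarrow> complex \<Rightarrow> complex \<Rightarrow> complex" where
  "upper_Macdonald_integral s a p =
     (LINT t:{1<..}|lborel. of_real (t powr (s - 1)) * exp (- a * of_real t) * exp (- p / of_real t))"

text \<open>
On \<open>{1<..}\<close> the negative powers of \<open>t\<close> from the expansion of \<open>exp (- p / t)\<close> are bounded by 1, so the
exponential series of the modulus of \<open>p\<close> dominates.
\<close>

lemma upper_Macdonald_integral_sums:
  fixes s :: real and a p :: complex
  assumes a: "Re a > 0"
  shows "set_integrable lborel {1<..} (\<lambda>t. of_real (t powr (s - 1)) * exp (- a * of_real t) * exp (- p / of_real t))"
    and "(\<lambda>k. (- p) ^ k / fact k * upper_Gamma_integral (s - real k) a) sums upper_Macdonald_integral s a p"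
proof -
  define f where "f = (\<lambda>k t. (- p) ^ k / fact k * (complex_of_real (t powr (s - real k - 1)) * exp (- a * of_real t)))"
  define h where "h = (\<lambda>k t. norm p ^ k / fact k * (t powr (s - 1) * exp (- Re a * t)))"
  have pw: "t powr (s - real k - 1) = t powr (s - 1) / t ^ k" if "t > 0" for t k
    using that by (simp add: powr_diff powr_realpow)
  have le: "norm (f k t) \<le> h k t" if "t \<in> {1<..}" for k t
  proof -
    have "t powr (s - real k - 1) \<le> t powr (s - 1)"
      using that by (intro powr_mono) auto
    thus ?thesis
      by (auto simp: f_def h_def norm_mult norm_divide norm_power intro!: mult_left_mono divide_right_mono mult_right_mono)
  qed
  have "continuous_on {1<..} (f k)" for k
    unfolding f_def by (intro continuous_intros) auto
  hence fm: "set_borel_measurable lborel {1<..} (f k)" for k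
    by (intro set_borel_measurable_continuous) auto
  have hint: "set_integrable lborel {1<..} (h k)" for k
    unfolding h_def by (intro set_integrable_mult_right upper_Gamma_integrable_real a)
  have ex: "summable (\<lambda>k. norm p ^ k / fact k)"
    using summable_exp_generic[of "norm p"] by (simp add: field_simps)
  have hsum: "summable (\<lambda>k. h k t)" for t
    unfolding h_def by (intro summable_mult2 ex)
  have hval: "summable (\<lambda>k. LINT t:{1<..}|lborel. h k t)"
    unfolding h_def set_integral_mult_right by (intro summable_mult2 ex)
  have fs: "(\<lambda>k. f k t) sums (of_real (t powr (s - 1)) * exp (- a * of_real t) * exp (- p / of_real t))"
    if "t \<in> {1<..}" for t
  proof -
    have "(\<lambda>k. of_real (t powr (s - 1)) * exp (- a * of_real t) * ((- p / of_real t) ^ k /\<^sub>R fact k)) sums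
       (of_real (t powr (s - 1)) * exp (- a * of_real t) * exp (- p / of_real t))"
      by (intro sums_mult exp_converges)
    also have "(\<lambda>k. of_real (t powr (s - 1)) * exp (- a * of_real t) * ((- p / of_real t) ^ k /\<^sub>R fact k)) = (\<lambda>k. f k t)"
    proof
      fix k
      have "t > 0" using that by simp
      from pw[OF this, of k] this
      show "of_real (t powr (s - 1)) * exp (- a * of_real t) * ((- p / of_real t) ^ k /\<^sub>R fact k) = f k t"
        unfolding f_def by (simp only: power_divide scaleR_conv_of_real) (simp add: divide_inverse mult_ac)
    qed
    finally show ?thesis .
  qed
  note * = set_integral_sums_dominated[of _ lborel f h, OF _ fm hint le hsum hval fs]
  show "set_integrable lborel {1<..} (\<lambda>t. of_real (t powr (s - 1)) * exp (- a * of_real t) * exp (- p / of_real t))"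
    by (rule *(1)) auto
  have "(\<lambda>k. LINT t:{1<..}|lborel. f k t) sums upper_Macdonald_integral s a p"
    unfolding upper_Macdonald_integral_def by (rule *(2)) auto
  also have "(\<lambda>k. LINT t:{1<..}|lborel. f k t) = (\<lambda>k. (- p) ^ k / fact k * upper_Gamma_integral (s - real k) a)"
    by (simp only: f_def set_integral_mult_right upper_Gamma_integral_def)
  finally show "(\<lambda>k. (- p) ^ k / fact k * upper_Gamma_integral (s - real k) a) sums upper_Macdonald_integral s a p" .
qed

text \<open>
Inversion exchanges the roles of \<open>a\<close> and \<open>p\<close>, and the Jacobian turns the order \<open>s\<close> into \<open>- s\<close>.
\<close>

lemma integral_inversion_substitution:
  fixes s :: real and a p :: complex
  assumes p: "Re p > 0"
  shows "set_integrable lborel {0<..<1} (\<lambda>t. of_real (t powr (s - 1)) * exp (- a * of_real t) * exp (- p / of_real t))"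
    and "(LINT t:{0<..<1}|lborel. of_real (t powr (s - 1)) * exp (- a * of_real t) * exp (- p / of_real t)) =
           upper_Macdonald_integral (- s) p a"
proof -
  define f where "f = (\<lambda>t. complex_of_real (t powr (s - 1)) * exp (- a * of_real t) * exp (- p / of_real t))"
  define g where "g = (\<lambda>t. complex_of_real (t powr (- s - 1)) * exp (- p * of_real t) * exp (- a / of_real t))"
  have img: "inverse ` {1<..} = {0<..<(1::real)}"
  proof (intro equalityI subsetI)
    fix x :: real assume "x \<in> {0<..<1}"
    thus "x \<in> inverse ` {1<..}"
      by (intro image_eqI[of _ _ "inverse x"]) (auto simp: one_less_inverse)
  qed (auto simp: inverse_less_1_iff)
  have eq: "\<bar>- inverse (t * t)\<bar> *\<^sub>R f (inverse t) = g t" if "t \<in> {1<..}" for t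
  proof -
    have t: "t > 0" using that by simp
    have "inverse (t * t) * inverse t powr (s - 1) = t powr (- s - 1)"
    proof -
      have "inverse (t * t) = t powr (- 2)" using t by (simp add: powr_minus powr_numeral power2_eq_square)
      moreover have "inverse t powr (s - 1) = t powr (1 - s)" using t by (simp add: inverse_powr powr_minus[symmetric])
      moreover have "(- 2) + (1 - s) = - s - 1" by simp
      ultimately show ?thesis by (simp only: powr_add[symmetric])
    qed
    hence "complex_of_real (inverse (t * t)) * complex_of_real (inverse t powr (s - 1)) = of_real (t powr (- s - 1))"
      by (simp only: of_real_mult[symmetric])
    thus ?thesis using t by (simp add: f_def g_def scaleR_conv_of_real divide_inverse mult_ac)
  qed
  have gm: "set_borel_measurable lborel {1<..} g"
    unfolding g_def by (intro set_borel_measurable_continuous continuous_intros) auto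
  have fm: "set_borel_measurable lborel {0<..<1} f"
    unfolding f_def by (intro set_borel_measurable_continuous continuous_intros) auto
  have gi: "set_integrable lborel {1<..} g"
    unfolding g_def by (rule upper_Macdonald_integral_sums(1)[OF p])
  have gi': "g absolutely_integrable_on {1<..}"
    using gi set_integrable_lebesgue_iff_lborel[OF gm] by simp
  have "(\<lambda>t. \<bar>- inverse (t * t)\<bar> *\<^sub>R f (inverse t)) absolutely_integrable_on {1<..} \<longleftrightarrow> g absolutely_integrable_on {1<..}"
    by (intro set_integrable_cong refl eq)
  moreover have "integral {1<..} (\<lambda>t. \<bar>- inverse (t * t)\<bar> *\<^sub>R f (inverse t)) = integral {1<..} g"
    by (intro Henstock_Kurzweil_Integration.integral_cong eq)
  ultimately have "f absolutely_integrable_on (inverse ` {1<..}) \<and> integral (inverse ` {1<..}) f = integral {1<..} g"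
    using gi' by (subst has_absolute_integral_change_of_variables_real[symmetric, where h = "\<lambda>t. - inverse (t * t)"])
                 (auto intro!: derivative_eq_intros inj_onI simp: field_simps)
  hence fi: "f absolutely_integrable_on {0<..<1}" "integral {0<..<1} f = integral {1<..} g" by (auto simp: img)
  show 1: "set_integrable lborel {0<..<1} (\<lambda>t. of_real (t powr (s - 1)) * exp (- a * of_real t) * exp (- p / of_real t))"
    using fi(1) set_integrable_lebesgue_iff_lborel[OF fm] by (simp add: f_def)
  show "(LINT t:{0<..<1}|lborel. of_real (t powr (s - 1)) * exp (- a * of_real t) * exp (- p / of_real t)) =
           upper_Macdonald_integral (- s) p a"
    using set_borel_integral_eq_integral(2)[OF 1] set_borel_integral_eq_integral(2)[OF gi] fi(2)
    by (simp add: f_def g_def upper_Macdonald_integral_def)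
qed

definition Macdonald_integral :: "real \<Rightarrow> complex \<Rightarrow> complex \<Rightarrow> complex" where
  "Macdonald_integral s a p =
     (LINT t:{0<..}|lborel. of_real (t powr (s - 1)) * exp (- a * of_real t) * exp (- p / of_real t))"

lemma Macdonald_integral_split:
  fixes s :: real and a p :: complex
  assumes a: "Re a > 0" and p: "Re p > 0"
  shows "Macdonald_integral s a p = upper_Macdonald_integral s a p + upper_Macdonald_integral (- s) p a"
proof -
  let ?f = "\<lambda>t. complex_of_real (t powr (s - 1)) * exp (- a * of_real t) * exp (- p / of_real t)"
  have "(LINT t:{0<..}|lborel. ?f t) = (LINT t:{0<..<1} \<union> {1<..}|lborel. ?f t)"
    by (rule set_integral_discrete_difference[of "{1}"]) auto
  also have "\<dots> = (LINT t:{0<..<1}|lborel. ?f t) + (LINT t:{1<..}|lborel. ?f t)"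
    by (rule set_integral_Un) (use integral_inversion_substitution(1)[OF p] upper_Macdonald_integral_sums(1)[OF a] in auto)
  finally show ?thesis
    using integral_inversion_substitution(2)[OF p, of s a]
    by (simp add: upper_Macdonald_integral_def Macdonald_integral_def)
qed

text \<open>
The series of the modified Bessel function \<open>I\<^sub>\<nu>\<close> at \<open>2 sqrt w\<close>, free of the branch of the root.
\<close>

definition Bessel_series :: "real \<Rightarrow> complex \<Rightarrow> complex" where
  "Bessel_series \<nu> w = (\<Sum>k. of_real (rGamma (\<nu> + real k + 1)) / fact k * w ^ k)"

text \<open>
The part of the expanded upper Macdonald integral that does not consist of complete Gamma values.
\<close>

definition mixed_Gamma_series :: "real \<Rightarrow> complex \<Rightarrow> complex \<Rightarrow> complex" where
  "mixed_Gamma_series s a p = (\<Sum>k. (- p) ^ k / fact k * lower_Gamma_series (s - real k) a)"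

text \<open>
Both series are the same double series up to sign, summed in opposite orders: exchanging
\<open>(s, a, p)\<close> with \<open>(- s, p, a)\<close> and the two indices negates the denominator \<open>s - j + k\<close>. This is the
cancellation that makes the cut at \<open>t = 1\<close> disappear from the result.
\<close>

lemma mixed_Gamma_series_antisym:
  assumes s: "s \<notin> \<int>"
  shows "summable (\<lambda>k. (- p) ^ k / fact k * lower_Gamma_series (s - real k) a)"
    and "mixed_Gamma_series (- s) p a = - mixed_Gamma_series s a p"
proof -
  obtain d where d: "d > 0" "\<And>m::int. d \<le> \<bar>s + of_int m\<bar>" using dist_Ints_bound[OF s] by blast
  have sk: "s - real k \<notin> \<int>" for k
    using s by (metis Ints_add Ints_of_nat diff_add_cancel)
  have sk': "- s - real k \<notin> \<int>" for k
    using s by (metis Ints_add Ints_minus Ints_of_nat diff_add_cancel minus_minus)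
  define c where "c = (\<lambda>j k. (- p) ^ j / fact j * ((- a) ^ k / (fact k * complex_of_real (s - real j + real k))))"
  have ex: "summable (\<lambda>k. norm x ^ k / fact k)" for x :: complex
    using summable_exp_generic[of "norm x"] by (simp add: field_simps)
  have le: "norm (c j k) \<le> (norm p ^ j / fact j) * (norm a ^ k / fact k * (1 / d))" for j k
  proof -
    have "d \<le> \<bar>s - real j + real k\<bar>" using d(2)[of "int k - int j"] by (simp add: algebra_simps)
    hence "1 / \<bar>s - real j + real k\<bar> \<le> 1 / d" using d(1) by (intro divide_left_mono) auto
    hence "(norm p ^ j / fact j) * (norm a ^ k / fact k * (1 / \<bar>s - real j + real k\<bar>)) \<le>
           (norm p ^ j / fact j) * (norm a ^ k / fact k * (1 / d))"
      by (intro mult_left_mono) auto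
    thus ?thesis unfolding c_def
      by (simp only: norm_mult norm_divide norm_power norm_minus_cancel norm_of_real norm_fact)
         (simp only: divide_inverse inverse_mult_distrib mult_ac mult_1_left)
  qed
  note sw = suminf_swap_dominated[of c, OF le ex _ summable_mult2[OF ex]]
  have row: "(\<Sum>k. c j k) = (- p) ^ j / fact j * lower_Gamma_series (s - real j) a" for j
  proof -
    have "(\<lambda>k. c j k) sums ((- p) ^ j / fact j * lower_Gamma_series (s - real j) a)"
      unfolding c_def by (intro sums_mult lower_Gamma_series_sums sk)
    thus ?thesis by (simp add: sums_iff)
  qed
  have col: "(\<Sum>j. c j k) = - ((- a) ^ k / fact k * lower_Gamma_series (- s - real k) p)" for k
  proof -
    have "(\<lambda>j. (- ((- a) ^ k / fact k)) * ((- p) ^ j / (fact j * of_real (- s - real k + real j)))) sums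
            ((- ((- a) ^ k / fact k)) * lower_Gamma_series (- s - real k) p)"
      by (intro sums_mult lower_Gamma_series_sums sk')
    also have "(\<lambda>j. (- ((- a) ^ k / fact k)) * ((- p) ^ j / (fact j * of_real (- s - real k + real j)))) = (\<lambda>j. c j k)"
    proof
      fix j
      have "complex_of_real (- s - real k + real j) = - complex_of_real (s - real j + real k)" by simp
      thus "(- ((- a) ^ k / fact k)) * ((- p) ^ j / (fact j * of_real (- s - real k + real j))) = c j k"
        unfolding c_def by (simp only: mult_minus_right divide_minus_right minus_mult_minus) (simp add: divide_inverse mult_ac)
    qed
    finally show ?thesis by (simp add: sums_iff)
  qed
  have "summable (\<lambda>j. \<Sum>k. c j k)" by (rule sw(1)) (use d in auto)
  thus "summable (\<lambda>k. (- p) ^ k / fact k * lower_Gamma_series (s - real k) a)" by (simp only: row)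
  have "mixed_Gamma_series s a p = (\<Sum>j. \<Sum>k. c j k)" by (simp only: row mixed_Gamma_series_def)
  also have "\<dots> = (\<Sum>k. \<Sum>j. c j k)" by (rule sw(2)) (use d in auto)
  also have "\<dots> = (\<Sum>k. - ((- a) ^ k / fact k * lower_Gamma_series (- s - real k) p))" by (simp only: col)
  finally have *: "mixed_Gamma_series s a p = (\<Sum>k. - ((- a) ^ k / fact k * lower_Gamma_series (- s - real k) p))" .
  have "norm (c j k) \<le> (norm a ^ k / fact k * (1 / d)) * (norm p ^ j / fact j)" for j k
    using le[of j k] by (simp add: mult_ac)
  \<comment> \<open>The interchange lemma with its indices exchanged gives convergence of the outer sum over \<open>k\<close>.\<close>
  from suminf_swap_dominated(1)[of "\<lambda>k j. c j k", OF this summable_mult2[OF ex] _ ex] d(1)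
  have "summable (\<lambda>k. - ((- a) ^ k / fact k * lower_Gamma_series (- s - real k) p))"
    by (simp add: col)
  hence "summable (\<lambda>k. ((- a) ^ k / fact k * lower_Gamma_series (- s - real k) p))"
    by (simp only: summable_minus_iff)
  thus "mixed_Gamma_series (- s) p a = - mixed_Gamma_series s a p"
    unfolding * by (subst suminf_minus) (simp_all add: mixed_Gamma_series_def)
qed

text \<open>
The complete Gamma values \<open>\<Gamma>(s - k)\<close> turn into \<open>1 / \<Gamma>(1 - s + k)\<close> by reflection. Their sign \<open>(-1)\<^sup>k\<close>
absorbs the one of \<open>(- p)\<^sup>k\<close>, which leaves the series of \<open>I\<close> rather than that of \<open>J\<close>.
\<close>

lemma upper_Macdonald_integral_eq:
  fixes s :: real and a p :: complex
  assumes a: "Re a > 0" and s: "s \<notin> \<int>"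
  shows "upper_Macdonald_integral s a p =
           of_real (pi / sin (s * pi)) * a powr (- of_real s) * Bessel_series (- s) (a * p) - mixed_Gamma_series s a p"
proof -
  have a0: "a \<noteq> 0" using a by auto
  have sk: "s - real k \<notin> \<int>" for k
    using s by (metis Ints_add Ints_of_nat diff_add_cancel)
  have sn0: "sin (s * pi) \<noteq> 0"
    using s by (auto simp: sin_zero_iff_int2)
  define C where "C = complex_of_real (pi / sin (s * pi)) * a powr (- of_real s)"
  have C0: "C \<noteq> 0" using sn0 a0 by (auto simp: C_def)
  have "(\<lambda>k. (- p) ^ k / fact k * upper_Gamma_integral (s - real k) a) sums upper_Macdonald_integral s a p"
    by (rule upper_Macdonald_integral_sums(2)[OF a])
  moreover have "(\<lambda>k. (- p) ^ k / fact k * lower_Gamma_series (s - real k) a) sums mixed_Gamma_series s a p"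
    unfolding mixed_Gamma_series_def by (intro summable_sums mixed_Gamma_series_antisym(1) s)
  ultimately have "(\<lambda>k. (- p) ^ k / fact k * upper_Gamma_integral (s - real k) a + (- p) ^ k / fact k * lower_Gamma_series (s - real k) a)
     sums (upper_Macdonald_integral s a p + mixed_Gamma_series s a p)"
    by (rule sums_add)
  also have "(\<lambda>k. (- p) ^ k / fact k * upper_Gamma_integral (s - real k) a + (- p) ^ k / fact k * lower_Gamma_series (s - real k) a) =
      (\<lambda>k. C * (of_real (rGamma (- s + real k + 1)) / fact k * (a * p) ^ k))"
  proof
    fix k
    have G: "Gamma (s - real k) = (-1) ^ k * (pi / sin (s * pi)) * rGamma (- s + real k + 1)"
    proof -
      have "rGamma (complex_of_real (s - real k)) * rGamma (1 - complex_of_real (s - real k)) =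
              sin (of_real pi * of_real (s - real k)) / of_real pi"
        by (rule rGamma_reflection_complex)
      hence "complex_of_real (rGamma (s - real k) * rGamma (1 - (s - real k))) = of_real (sin (pi * (s - real k)) / pi)"
        by (simp only: rGamma_complex_of_real[symmetric] of_real_mult of_real_divide sin_of_real[symmetric] of_real_diff of_real_1)
      hence "rGamma (s - real k) * rGamma (1 - (s - real k)) = sin (pi * (s - real k)) / pi"
        by (simp only: of_real_eq_iff)
      also have "sin (pi * (s - real k)) = (-1) ^ k * sin (s * pi)"
        by (simp add: right_diff_distrib sin_diff mult_ac)
      finally have *: "rGamma (s - real k) * rGamma (- s + real k + 1) = (-1) ^ k * sin (s * pi) / pi"
        by (simp add: algebra_simps)
      have one: "(-1::real) ^ k * (-1) ^ k = 1" by (simp flip: power_mult_distrib)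
      have "rGamma (s - real k) * ((-1) ^ k * (pi / sin (s * pi)) * rGamma (- s + real k + 1)) = 1"
      proof -
        have "rGamma (s - real k) * ((-1) ^ k * (pi / sin (s * pi)) * rGamma (- s + real k + 1)) =
            (-1) ^ k * (pi / sin (s * pi)) * (rGamma (s - real k) * rGamma (- s + real k + 1))"
          by (simp only: mult_ac)
        also have "\<dots> = (-1) ^ k * (-1) ^ k" unfolding * using sn0 by simp
        finally show ?thesis by (simp only: one)
      qed
      thus ?thesis unfolding Gamma_def by (rule inverse_unique)
    qed
    have P: "a powr (- of_real (s - real k)) = a powr (- of_real s) * a ^ k"
    proof -
      have "a powr (- of_real (s - real k)) = a powr (- of_real s + of_nat k)" by simp
      also have "\<dots> = a powr (- of_real s) * a powr (of_nat k)" by (rule powr_add)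
      finally show ?thesis using a0 by (simp add: powr_nat)
    qed
    have one: "(- p) ^ k * (-1) ^ k = p ^ k" by (simp flip: power_mult_distrib)
    have "(- p) ^ k / fact k * upper_Gamma_integral (s - real k) a + (- p) ^ k / fact k * lower_Gamma_series (s - real k) a =
       (- p) ^ k / fact k * (of_real (Gamma (s - real k)) * a powr (- of_real (s - real k)))"
      by (simp only: upper_Gamma_integral_eq[OF a sk] distrib_left[symmetric] diff_add_cancel)
    also have "\<dots> = ((- p) ^ k * (-1) ^ k) / fact k * (of_real (pi / sin (s * pi)) * of_real (rGamma (- s + real k + 1)) * (a powr (- of_real s) * a ^ k))"
      unfolding G P by simp
    also have "\<dots> = C * (of_real (rGamma (- s + real k + 1)) / fact k * (a * p) ^ k)"
      unfolding one C_def by (simp only: power_mult_distrib divide_inverse mult_ac)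
    finally show "(- p) ^ k / fact k * upper_Gamma_integral (s - real k) a + (- p) ^ k / fact k * lower_Gamma_series (s - real k) a =
       C * (of_real (rGamma (- s + real k + 1)) / fact k * (a * p) ^ k)" .
  qed
  finally have S: "(\<lambda>k. C * (of_real (rGamma (- s + real k + 1)) / fact k * (a * p) ^ k)) sums
     (upper_Macdonald_integral s a p + mixed_Gamma_series s a p)" .
  \<comment> \<open>The mixed series converges by itself, so the remaining Bessel series does as well.\<close>
  hence "summable (\<lambda>k. C * (of_real (rGamma (- s + real k + 1)) / fact k * (a * p) ^ k))"
    by (rule sums_summable)
  hence "summable (\<lambda>k. of_real (rGamma (- s + real k + 1)) / fact k * (a * p) ^ k)"
    using C0 by (subst (asm) summable_cmult_iff) simp
  from sums_mult[OF summable_sums[OF this], of C] S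
  have "upper_Macdonald_integral s a p + mixed_Gamma_series s a p = C * Bessel_series (- s) (a * p)"
    unfolding Bessel_series_def by (rule sums_unique2[rotated])
  thus ?thesis by (simp add: C_def algebra_simps)
qed

section \<open>The Macdonald integral as a Bessel function\<close>

lemma Bessel_I_csqrt:
  "Bessel_I \<nu> (2 * csqrt u) = csqrt u powr of_real \<nu> * Bessel_series \<nu> u"
proof -
  have "(2 * csqrt u / 2) ^ (2 * k) = u ^ k" for k
    by (simp only: power_mult) simp
  thus ?thesis by (simp only: Bessel_I_def Bessel_series_def) simp
qed

text \<open>
In the right half-plane the arguments of \<open>a\<close> and \<open>p\<close> add up to less than \<open>\<pi>\<close>, so principal
logarithms are additive and all principal powers are compatible.
\<close>

lemma csqrt_mult_powr:
  fixes a p :: complex and s :: real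
  assumes a: "Re a > 0" and p: "Re p > 0"
  shows "csqrt (p * a) powr of_real s = p powr (of_real s / 2) * a powr (of_real s / 2)"
proof -
  have nz: "a \<noteq> 0" "p \<noteq> 0" using a p by auto
  have Im: "\<bar>Im (Ln a)\<bar> < pi / 2" "\<bar>Im (Ln p)\<bar> < pi / 2"
    using a p nz Re_Ln_pos_lt by auto
  have L: "Ln (p * a) = Ln p + Ln a"
    using nz Im by (intro Ln_times_simple) (auto simp: abs_less_iff)
  have "csqrt (p * a) = exp ((Ln p + Ln a) / 2)"
    using nz by (simp add: csqrt_exp_Ln L)
  moreover have "Ln (exp ((Ln p + Ln a) / 2)) = (Ln p + Ln a) / 2"
    using Im by (intro Ln_exp) (auto simp: abs_less_iff)
  ultimately have "csqrt (p * a) powr of_real s = exp (of_real s * ((Ln p + Ln a) / 2))"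
    by (simp only: powr_def exp_not_eq_zero if_False)
  also have "\<dots> = exp (of_real s / 2 * Ln p) * exp (of_real s / 2 * Ln a)"
    by (simp only: exp_add[symmetric]) (simp add: field_simps)
  finally show ?thesis using nz by (simp add: powr_def)
qed

text \<open>
The left-hand side is the quotient whose value or limit in the order is \<open>K\<close>.
\<close>

lemma Macdonald_integral_nonint:
  fixes s :: real and a p :: complex
  assumes a: "Re a > 0" and p: "Re p > 0" and s: "s \<notin> \<int>"
  shows "of_real (pi / 2) * (Bessel_I (- s) (2 * csqrt (p * a)) - Bessel_I s (2 * csqrt (p * a))) / of_real (sin (s * pi)) =
           Macdonald_integral s a p / (2 * (p powr (of_real s / 2) * a powr (- of_real s / 2)))"
proof -
  have nz: "a \<noteq> 0" "p \<noteq> 0" using a p by auto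
  have s': "- s \<notin> \<int>" using s by simp
  have sn0: "sin (s * pi) \<noteq> 0" using s by (auto simp: sin_zero_iff_int2)
  define P where "P = p powr (of_real s / 2)"
  define A where "A = a powr (of_real s / 2)"
  have PA: "P \<noteq> 0" "A \<noteq> 0" using nz by (auto simp: P_def A_def)
  have "Macdonald_integral s a p = upper_Macdonald_integral s a p + upper_Macdonald_integral (- s) p a"
    by (rule Macdonald_integral_split[OF a p])
  also have "\<dots> = of_real (pi / sin (s * pi)) * a powr (- of_real s) * Bessel_series (- s) (a * p)
       + of_real (pi / sin (- s * pi)) * p powr (- of_real (- s)) * Bessel_series (- (- s)) (p * a)"
    by (simp only: upper_Macdonald_integral_eq[OF a s] upper_Macdonald_integral_eq[OF p s']
          mixed_Gamma_series_antisym(2)[OF s]) (simp add: algebra_simps)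
  also have "of_real (pi / sin (- s * pi)) = - complex_of_real (pi / sin (s * pi))" by simp
  also have "a powr (- of_real s) = 1 / (A * A)"
  proof -
    have "A * A = a powr (of_real s)" by (simp add: A_def flip: powr_add)
    thus ?thesis by (simp add: powr_minus divide_inverse)
  qed
  also have "p powr (- of_real (- s)) = P * P"
    by (simp add: P_def flip: powr_add)
  finally have M: "Macdonald_integral s a p = of_real (pi / sin (s * pi)) *
      (Bessel_series (- s) (p * a) / (A * A) - P * P * Bessel_series s (p * a))"
    by (simp add: algebra_simps)
  have w: "csqrt (p * a) powr of_real s = P * A"
    using csqrt_mult_powr[OF a p, of s] by (simp add: P_def A_def)
  have w': "csqrt (p * a) powr of_real (- s) = 1 / (P * A)"
    unfolding w[symmetric] by (simp add: powr_minus divide_inverse)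
  have A': "a powr (- of_real s / 2) = 1 / A"
  proof -
    have "- of_real s / 2 = - (of_real s / 2 :: complex)" by simp
    thus ?thesis by (simp only: powr_minus inverse_eq_divide A_def)
  qed
  have alg: "x / 2 * (1 / (P * A) * u - P * A * v) / y = (x / y * (u / (A * A) - P * P * v)) / (2 * (P * (1 / A)))"
    for x y u v :: complex
  proof -
    have "1 / (P * A) * u - P * A * v = (u / (A * A) - P * P * v) * (A / P)"
      unfolding left_diff_distrib using PA by simp
    thus ?thesis by (simp add: mult_ac)
  qed
  show ?thesis
    unfolding Bessel_I_csqrt w w' A' M P_def[symmetric] of_real_divide of_real_numeral
    by (rule alg)
qed

text \<open>
Dominated convergence: for orders between \<open>\<alpha>\<close> and \<open>\<beta>\<close> the power of \<open>t\<close> is at most the sum of the two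
extreme powers, one of which dominates on each side of \<open>t = 1\<close>.
\<close>

lemma continuous_on_Macdonald_integral:
  fixes a p :: complex
  assumes a: "Re a > 0" and p: "Re p > 0" and \<alpha>: "\<alpha> > 0"
  shows "continuous_on {\<alpha>..\<beta>} (\<lambda>s. Macdonald_integral s a p)"
proof -
  let ?f = "\<lambda>s t. indicator {0<..} t *\<^sub>R (complex_of_real (t powr (s - 1)) * exp (- a * of_real t) * exp (- p / of_real t))"
  let ?w = "\<lambda>t. indicator {0<..} t *\<^sub>R (t powr (\<alpha> - 1) * exp (- Re a * t) + t powr (\<beta> - 1) * exp (- Re a * t))"
  have fm: "?f s \<in> borel_measurable lborel" for s
  proof -
    have "set_borel_measurable lborel {0<..} (\<lambda>t. complex_of_real (t powr (s - 1)) * exp (- a * of_real t) * exp (- p / of_real t))"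
      by (intro set_borel_measurable_continuous continuous_intros) auto
    thus ?thesis by (simp add: set_borel_measurable_def)
  qed
  show ?thesis
  proof (cases "\<alpha> \<le> \<beta>")
    case True
    show ?thesis
      unfolding continuous_on_sequentially
    proof safe
      fix x :: "nat \<Rightarrow> real" and s
      assume s: "s \<in> {\<alpha>..\<beta>}" and x: "\<forall>n. x n \<in> {\<alpha>..\<beta>}" and lim: "x \<longlonglongrightarrow> s"
      have "(\<lambda>n. LINT t|lborel. ?f (x n) t) \<longlonglongrightarrow> (LINT t|lborel. ?f s t)"
      proof (rule integral_dominated_convergence[where w = ?w])
        show "integrable lborel ?w"
          using set_integral_add(1)[OF set_integrable_Gamma_scaled[of \<alpha> "Re a"] set_integrable_Gamma_scaled[of \<beta> "Re a"]]
            a \<alpha> True by (simp add: set_integrable_def)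
        show "AE t in lborel. (\<lambda>n. ?f (x n) t) \<longlonglongrightarrow> ?f s t"
        proof (rule AE_I2)
          fix t :: real
          show "(\<lambda>n. ?f (x n) t) \<longlonglongrightarrow> ?f s t"
          proof (cases "t > 0")
            case t: True
            show ?thesis using t by (intro tendsto_intros lim) auto
          qed auto
        qed
        show "AE t in lborel. norm (?f (x n) t) \<le> ?w t" for n
        proof (rule AE_I2)
          fix t :: real
          show "norm (?f (x n) t) \<le> ?w t"
          proof (cases "t > 0")
            case t: True
            have "Re (p / of_real t) \<ge> 0" using t p by simp
            hence e: "norm (exp (- p / of_real t)) \<le> 1" by simp
            have "t powr (x n - 1) \<le> t powr (\<alpha> - 1) + t powr (\<beta> - 1)"
            proof (cases "t \<ge> 1")
              case True
              have "t powr (x n - 1) \<le> t powr (\<beta> - 1)" using x True by (intro powr_mono) auto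
              thus ?thesis by (simp add: add_increasing)
            next
              case False
              have "t powr (x n - 1) \<le> t powr (\<alpha> - 1)" using x False t by (intro powr_mono') auto
              thus ?thesis by (simp add: add_increasing2)
            qed
            hence "t powr (x n - 1) * exp (- Re a * t) * norm (exp (- p / of_real t)) \<le>
               (t powr (\<alpha> - 1) + t powr (\<beta> - 1)) * exp (- Re a * t) * 1"
              using e by (intro mult_mono) auto
            thus ?thesis using t by (simp add: norm_mult distrib_right)
          qed auto
        qed
      qed (rule fm)+
      thus "((\<lambda>s. Macdonald_integral s a p) \<circ> x) \<longlonglongrightarrow> Macdonald_integral s a p"
        by (simp add: Macdonald_integral_def set_lebesgue_integral_def o_def)
    qed
  qed auto
qed

text \<open>
At an integer order the defining limit only sees nearby non-integer orders, where \<open>K\<close> is the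
normalised integral; continuity of the integral evaluates the limit.
\<close>

theorem Macdonald_integral_eq_Bessel_K:
  fixes a p :: complex
  assumes a: "Re a > 0" and p: "Re p > 0" and s: "s > 0"
  shows "Macdonald_integral s a p =
     2 * (p powr (of_real s / 2) * a powr (- of_real s / 2)) * Bessel_K s (2 * csqrt (p * a))"
proof -
  have nz: "a \<noteq> 0" "p \<noteq> 0" using a p by auto
  define q where "q = (\<lambda>w. of_real (pi / 2) * (Bessel_I (- w) (2 * csqrt (p * a)) - Bessel_I w (2 * csqrt (p * a))) / of_real (sin (w * pi)))"
  define Q where "Q = (\<lambda>s. Macdonald_integral s a p / (2 * (p powr (of_real s / 2) * a powr (- of_real s / 2))))"
  have qQ: "q w = Q w" if "w \<notin> \<int>" for w
    unfolding q_def Q_def by (rule Macdonald_integral_nonint[OF a p that])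
  have "Bessel_K s (2 * csqrt (p * a)) = Q s"
  proof (cases "s \<in> \<int>")
    case False
    thus ?thesis using qQ[OF False] by (simp add: Bessel_K_def q_def)
  next
    case True
    have "s \<in> interior {s / 2..s + 1}" using s by simp
    hence "isCont (\<lambda>s. Macdonald_integral s a p) s"
      using continuous_on_interior[OF continuous_on_Macdonald_integral[OF a p, of "s / 2" "s + 1"]] s by simp
    moreover have "a \<notin> \<real>\<^sub>\<le>\<^sub>0" "p \<notin> \<real>\<^sub>\<le>\<^sub>0" using a p by (auto simp: complex_nonpos_Reals_iff)
    ultimately have "isCont Q s" unfolding Q_def using nz by (intro continuous_intros) auto
    hence "(Q \<longlongrightarrow> Q s) (at s)" by (simp add: isCont_def)
    moreover have "eventually (\<lambda>w. q w = Q w) (at s)"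
    proof -
      have "w \<notin> \<int>" if "w \<noteq> s" "dist w s < 1" for w
      proof
        assume "w \<in> \<int>"
        then obtain m n where "w = of_int m" "s = of_int n" using True by (auto elim!: Ints_cases)
        thus False using that by (auto simp: dist_real_def simp flip: of_int_diff of_int_abs)
      qed
      thus ?thesis using qQ by (auto simp: eventually_at intro!: exI[of _ 1])
    qed
    ultimately have "(q \<longlongrightarrow> Q s) (at s)" by (subst filterlim_cong[OF refl refl, of q Q]) auto
    hence "Lim (at s) q = Q s" by (intro tendsto_Lim) auto
    thus ?thesis using True by (simp add: Bessel_K_def q_def)
  qed
  thus ?thesis using nz by (simp add: Q_def)
qed

section \<open>Bessel functions of half-integer order\<close>

text \<open>
The duplication formula at half-integers, which turns products \<open>k! \<Gamma>(k + 3/2)\<close> into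
\<open>(2k + 1)!\<close> and so the series of \<open>J\<close> into those of sine and cosine.
\<close>

lemma rGamma_half_integer:
  "rGamma (1 / 2 + real k + 1) = 2 ^ (2 * k + 1) * fact k / (sqrt pi * fact (2 * k + 1))"
proof (induction k)
  case 0
  have "(1 / 2) * rGamma (1 / 2 + 1) = rGamma (1 / 2 :: real)" by (rule rGamma_plus1)
  moreover have "rGamma (1 / 2 :: real) = 1 / sqrt pi"
    by (simp add: rGamma_inverse_Gamma Gamma_one_half_real inverse_eq_divide)
  ultimately show ?case by (simp add: field_simps)
next
  case (Suc k)
  define x where "x = 1 / 2 + real k + 1"
  have x: "x \<noteq> 0" "x * 2 = real (2 * k + 3)" by (auto simp: x_def)
  have "x * rGamma (x + 1) = rGamma x" by (rule rGamma_plus1)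
  hence "rGamma (x + 1) = rGamma x / x" using x by (simp add: field_simps)
  also have "\<dots> = rGamma x * 2 / real (2 * k + 3)" unfolding x(2)[symmetric] by simp
  also have "rGamma x = 2 ^ (2 * k + 1) * fact k / (sqrt pi * fact (2 * k + 1))"
    using Suc.IH by (simp add: x_def)
  also have "\<dots> * 2 / real (2 * k + 3) = 2 ^ (2 * Suc k + 1) * fact (Suc k) / (sqrt pi * fact (2 * Suc k + 1))"
  proof -
    have f: "fact (2 * Suc k + 1) = real (2 * k + 3) * (2 * real (Suc k)) * fact (2 * k + 1)"
      by (simp add: algebra_simps)
    have g: "fact (Suc k) = real (Suc k) * fact k" by simp
    have h: "(2::real) ^ (2 * Suc k + 1) = 4 * 2 ^ (2 * k + 1)" by simp
    have alg: "u / (w * v) * 2 / m = (4 * p * (n * q)) / (w * (m * (2 * n) * v))"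
      if "n \<noteq> 0" "u = p * q" for u w v m p n q :: real
      using that by (simp add: mult_ac)
    show ?thesis unfolding f g h by (rule alg) simp_all
  qed
  finally show ?case by (simp add: x_def add_ac)
qed

lemma Bessel_J_one_half:
  assumes x: "x > 0"
  shows "Bessel_J (1 / 2) (of_real x) = of_real ((x / 2) powr (1 / 2) * (2 / (sqrt pi * x)) * sin x)"
proof -
  define g where "g = (\<lambda>k. (-1) ^ k * rGamma (1 / 2 + real k + 1) / fact k * (x / 2) ^ (2 * k))"
  have "(\<lambda>k. 2 / (sqrt pi * x) * ((- 1) ^ k / fact (2 * k + 1) * x ^ (2 * k + 1))) sums (2 / (sqrt pi * x) * sin x)"
    by (intro sums_mult sin_paired)
  also have "(\<lambda>k. 2 / (sqrt pi * x) * ((- 1) ^ k / fact (2 * k + 1) * x ^ (2 * k + 1))) = g"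
  proof
    fix k
    have e: "(2::real) ^ (2 * k + 1) = 2 * 2 ^ (2 * k)" "x ^ (2 * k + 1) = x ^ (2 * k) * x" by simp_all
    have "2 / (s * x) * (u / v * (y * x)) = u * (2 * z * w / (s * v)) / w * (y / z)"
      if "z \<noteq> 0" "w \<noteq> 0" for s u v w y z :: real
      using that x by simp
    from this[of "2 ^ (2 * k)" "fact k" "sqrt pi" "(-1) ^ k" "fact (2 * k + 1)" "x ^ (2 * k)"]
    show "2 / (sqrt pi * x) * ((- 1) ^ k / fact (2 * k + 1) * x ^ (2 * k + 1)) = g k"
      unfolding g_def rGamma_half_integer power_divide e by simp
  qed
  finally have "(\<lambda>k. complex_of_real (g k)) sums of_real (2 / (sqrt pi * x) * sin x)"
    by (rule sums_of_real)
  hence "(\<Sum>k. complex_of_real (g k)) = of_real (2 / (sqrt pi * x) * sin x)"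
    by (simp only: sums_iff)
  moreover have "(complex_of_real x / 2) powr of_real (1 / 2) = of_real ((x / 2) powr (1 / 2))"
    using x by (subst powr_of_real[symmetric]) auto
  ultimately show ?thesis
    unfolding Bessel_J_def by (simp only:) (simp add: g_def)
qed

text \<open>
The constant terms of \<open>sin x / x\<close> and \<open>cos x\<close> cancel, hence the shift by one and the division by
\<open>x\<^sup>2\<close>.
\<close>

lemma sin_over_self_minus_cos_sums:
  fixes x :: real
  assumes "x \<noteq> 0"
  shows "(\<lambda>k. (-1) ^ k * (2 * real k + 2) / fact (2 * k + 3) * x ^ (2 * k)) sums ((sin x / x - cos x) / x\<^sup>2)"
proof -
  define h where "h = (\<lambda>k. (-1) ^ k * (- 2 * real k) / fact (2 * k + 1) * x ^ (2 * k))"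
  have "(\<lambda>k. (- 1) ^ k / fact (2 * k + 1) * x ^ (2 * k + 1) / x - (- 1) ^ k / fact (2 * k) * x ^ (2 * k))
     sums (sin x / x - cos x)"
    by (intro sums_diff sums_divide sin_paired cos_paired)
  also have "(\<lambda>k. (- 1) ^ k / fact (2 * k + 1) * x ^ (2 * k + 1) / x - (- 1) ^ k / fact (2 * k) * x ^ (2 * k)) = h"
  proof
    fix k
    have f: "fact (2 * k + 1) = (2 * real k + 1) * fact (2 * k)" by simp
    have "e / (m * v) * (y * x) / x - e / v * y = e * (1 - m) / (m * v) * y" if "m \<noteq> 0" "v \<noteq> 0" for e m v y
      using that assms by (simp add: field_simps)
    from this[of "2 * real k + 1" "fact (2 * k)" "(-1) ^ k" "x ^ (2 * k)"]
    show "(- 1) ^ k / fact (2 * k + 1) * x ^ (2 * k + 1) / x - (- 1) ^ k / fact (2 * k) * x ^ (2 * k) = h k"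
      unfolding h_def f by (simp add: mult_ac)
  qed
  finally have "(\<lambda>k. h (Suc k)) sums (sin x / x - cos x)"
    by (subst sums_Suc_iff) (simp add: h_def)
  hence "(\<lambda>k. h (Suc k) / x\<^sup>2) sums ((sin x / x - cos x) / x\<^sup>2)"
    by (rule sums_divide)
  also have "(\<lambda>k. h (Suc k) / x\<^sup>2) = (\<lambda>k. (-1) ^ k * (2 * real k + 2) / fact (2 * k + 3) * x ^ (2 * k))"
  proof
    fix k
    have e: "2 * Suc k + 1 = 2 * k + 3" "x ^ (2 * Suc k) = x ^ (2 * k) * x\<^sup>2"
      by (simp_all add: power2_eq_square)
    show "h (Suc k) / x\<^sup>2 = (-1) ^ k * (2 * real k + 2) / fact (2 * k + 3) * x ^ (2 * k)"
    proof -
      have "- 2 * real (Suc k) = - (2 * real k + 2)" "(-1::real) ^ Suc k = - ((-1) ^ k)" by simp_all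
      thus ?thesis unfolding h_def e using assms by (simp only: mult_minus_left mult_minus_right minus_minus) simp
    qed
  qed
  finally show ?thesis .
qed

lemma Bessel_J_three_halves:
  assumes x: "x > 0"
  shows "Bessel_J (3 / 2) (of_real x) = of_real ((x / 2) powr (3 / 2) * (4 / sqrt pi) * ((sin x / x - cos x) / x\<^sup>2))"
proof -
  define g where "g = (\<lambda>k. (-1) ^ k * rGamma (3 / 2 + real k + 1) / fact k * (x / 2) ^ (2 * k))"
  have "(\<lambda>k. 4 / sqrt pi * ((-1) ^ k * (2 * real k + 2) / fact (2 * k + 3) * x ^ (2 * k))) sums
      (4 / sqrt pi * ((sin x / x - cos x) / x\<^sup>2))"
    using x by (intro sums_mult sin_over_self_minus_cos_sums) auto
  also have "(\<lambda>k. 4 / sqrt pi * ((-1) ^ k * (2 * real k + 2) / fact (2 * k + 3) * x ^ (2 * k))) = g"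
  proof
    fix k
    have "3 / 2 + real k + 1 = 1 / 2 + real (Suc k) + 1" by simp
    hence r: "rGamma (3 / 2 + real k + 1) = 2 ^ (2 * Suc k + 1) * fact (Suc k) / (sqrt pi * fact (2 * Suc k + 1))"
      by (simp only: rGamma_half_integer)
    have e: "2 * Suc k + 1 = 2 * k + 3" "(2::real) ^ (2 * k + 3) = 8 * 2 ^ (2 * k)"
        "(x / 2) ^ (2 * k) = x ^ (2 * k) / 2 ^ (2 * k)" "fact (Suc k) = real (Suc k) * fact k"
      by (simp_all add: power_add power_divide)
    have "4 / s * (u * (2 * l + 2) / v * y) = u * (8 * z * ((1 + l) * w) / (s * v)) / w * (y / z)"
      if "z \<noteq> 0" "w \<noteq> 0" "s \<noteq> 0" "v \<noteq> 0" for s u l v y z w :: real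
      using that by (simp add: field_simps)
    from this[of "2 ^ (2 * k)" "fact k" "sqrt pi" "fact (2 * k + 3)" "(-1) ^ k" "real k" "x ^ (2 * k)"]
    show "4 / sqrt pi * ((-1) ^ k * (2 * real k + 2) / fact (2 * k + 3) * x ^ (2 * k)) = g k"
      unfolding g_def r e by simp
  qed
  finally have "(\<lambda>k. complex_of_real (g k)) sums of_real (4 / sqrt pi * ((sin x / x - cos x) / x\<^sup>2))"
    by (rule sums_of_real)
  hence "(\<Sum>k. complex_of_real (g k)) = of_real (4 / sqrt pi * ((sin x / x - cos x) / x\<^sup>2))"
    by (simp only: sums_iff)
  moreover have "(complex_of_real x / 2) powr of_real (3 / 2) = of_real ((x / 2) powr (3 / 2))"
    using x by (subst powr_of_real[symmetric]) auto
  moreover have "(\<lambda>k. (- 1) ^ k * complex_of_real (rGamma (3 / 2 + real k + 1)) / fact k * (complex_of_real x / 2) ^ (2 * k)) =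
      (\<lambda>k. complex_of_real (g k))"
    by (simp add: g_def)
  ultimately show ?thesis
    unfolding Bessel_J_def by (simp only: of_real_mult mult.assoc)
qed

section \<open>The extended Mathieu series\<close>

text \<open>
Bounded factors \<open>c\<close> cover both the sine and the cosine. The terms of the geometric series of
\<open>1 / (exp t - 1)\<close> have integrals at most \<open>\<Gamma>(s) / n\<^sup>s\<close>, summable because \<open>s > 1\<close>.
\<close>

lemma Planck_expansion:
  fixes p :: complex and c :: "real \<Rightarrow> real" and s :: real
  assumes p: "Re p > 0" and s: "s > 1"
    and c: "continuous_on {0<..} c" "\<And>t. \<bar>c t\<bar> \<le> 1"
  defines "f \<equiv> \<lambda>n t. of_real (c t) * (of_real (t powr (s - 1)) * exp (- of_nat (Suc n) * of_real t) * exp (- p / of_real t))"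
  defines "F \<equiv> \<lambda>t. of_real (c t) * (of_real (t powr (s - 1)) * exp (- p / of_real t) / of_real (exp t - 1))"
  shows "set_integrable lborel {0<..} F"
    and "(\<lambda>n. LINT t:{0<..}|lborel. f n t) sums (LINT t:{0<..}|lborel. F t)"
proof -
  define h where "h = (\<lambda>n t. t powr (s - 1) * exp (- real (Suc n) * t))"
  have fm: "set_borel_measurable lborel {0<..} (f n)" for n
    unfolding f_def using c(1) by (intro set_borel_measurable_continuous continuous_intros) auto
  have hint: "set_integrable lborel {0<..} (h n)" for n
    unfolding h_def using s by (intro set_integrable_Gamma_scaled) auto
  have le: "norm (f n t) \<le> h n t" if "t \<in> {0<..}" for n t
  proof -
    have e: "norm (exp (- p / of_real t)) \<le> 1" using that p by simp
    have e2: "norm (exp (- of_nat (Suc n) * complex_of_real t)) = exp (- real (Suc n) * t)"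
      by simp
    have "norm (f n t) = \<bar>c t\<bar> * (t powr (s - 1) * exp (- real (Suc n) * t)) * norm (exp (- p / of_real t))"
      unfolding f_def by (simp only: norm_mult e2 norm_of_real mult_ac) simp
    also have "\<dots> \<le> 1 * (t powr (s - 1) * exp (- real (Suc n) * t)) * 1"
      using c(2)[of t] e by (intro mult_mono) auto
    finally show ?thesis by (simp add: h_def)
  qed
  have geo: "(\<lambda>n. exp (- real (Suc n) * t)) sums (1 / (exp t - 1))" if "t > 0" for t :: real
  proof -
    have "(\<lambda>n. exp (- t) * exp (- t) ^ n) sums (exp (- t) * (1 / (1 - exp (- t))))"
      using that by (intro sums_mult geometric_sums) auto
    also have "exp (- t) * (1 / (1 - exp (- t))) = 1 / (exp t - 1)"
      using that by (simp add: exp_minus field_simps)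
    also have "(\<lambda>n. exp (- t) * exp (- t) ^ n) = (\<lambda>n. exp (- real (Suc n) * t))"
      by (simp add: exp_of_nat_mult[symmetric] exp_add[symmetric] algebra_simps)
    finally show ?thesis .
  qed
  have hsum: "summable (\<lambda>n. h n t)" if "t \<in> {0<..}" for t
    unfolding h_def using that by (intro summable_mult sums_summable[OF geo]) auto
  have hval: "summable (\<lambda>n. LINT t:{0<..}|lborel. h n t)"
  proof -
    have "summable (\<lambda>n. real n powr (- s))" using s by (simp add: summable_real_powr_iff)
    hence "summable (\<lambda>n. Gamma s * real (Suc n) powr (- s))"
      by (intro summable_mult) (subst summable_Suc_iff)
    also have "(\<lambda>n. Gamma s * real (Suc n) powr (- s)) = (\<lambda>n. LINT t:{0<..}|lborel. h n t)"
      unfolding h_def using s by (subst set_integral_Gamma_scaled) (auto simp: powr_minus divide_inverse)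
    finally show ?thesis .
  qed
  have fs: "(\<lambda>n. f n t) sums F t" if "t \<in> {0<..}" for t
  proof -
    have "(\<lambda>n. complex_of_real (exp (- real (Suc n) * t))) sums of_real (1 / (exp t - 1))"
      using that by (intro sums_of_real geo) auto
    hence "(\<lambda>n. (of_real (c t) * (of_real (t powr (s - 1)) * exp (- p / of_real t))) * complex_of_real (exp (- real (Suc n) * t))) sums
        ((of_real (c t) * (of_real (t powr (s - 1)) * exp (- p / of_real t))) * of_real (1 / (exp t - 1)))"
      by (rule sums_mult)
    also have "(\<lambda>n. (of_real (c t) * (of_real (t powr (s - 1)) * exp (- p / of_real t))) * complex_of_real (exp (- real (Suc n) * t))) = (\<lambda>n. f n t)"
      by (simp add: f_def exp_of_real[symmetric] mult_ac)
    also have "(of_real (c t) * (of_real (t powr (s - 1)) * exp (- p / of_real t))) * of_real (1 / (exp t - 1)) = F t"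
      by (simp add: F_def)
    finally show ?thesis .
  qed
  note * = set_integral_sums_dominated[of _ lborel f h, OF _ fm hint le hsum hval fs]
  show "set_integrable lborel {0<..} F" by (rule *(1)) auto
  show "(\<lambda>n. LINT t:{0<..}|lborel. f n t) sums (LINT t:{0<..}|lborel. F t)" by (rule *(2)) auto
qed

lemma ext_Mathieu_1:
  assumes r: "r > 0"
  shows "ext_Mathieu 1 p r = of_real (1 / r) *
     (LINT t:{0<..}|lborel. of_real (sin (r * t)) * (of_real (t powr (2 - 1)) * exp (- p / of_real t) / of_real (exp t - 1)))"
proof -
  define c where "c = (r / 2) powr (1 / 2) * (2 / (sqrt pi * r))"
  let ?g = "\<lambda>t. of_real (sin (r * t)) * (of_real (t powr (2 - 1)) * exp (- p / of_real t) / of_real (exp t - 1))"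
  have "of_real (t powr (1 + 1 / 2)) * exp (- p / of_real t) / of_real (exp t - 1) * Bessel_J (1 - 1 / 2) (of_real (r * t))
      = of_real c * ?g t" if "t > 0" for t
  proof -
    have pw: "t powr (1 + 1 / 2) * ((r * t / 2) powr (1 / 2) * (2 / (sqrt pi * (r * t)))) = c * t powr (2 - 1)"
    proof -
      have "(r * t / 2) powr (1 / 2) = (r / 2) powr (1 / 2) * t powr (1 / 2)"
        using r that by (simp flip: powr_mult)
      moreover have "t powr (1 + 1 / 2) = t * t powr (1 / 2)" using that by (simp only: powr_add) simp
      moreover have "t powr (1 / 2) * t powr (1 / 2) = t" using that by (simp flip: powr_add)
      moreover have "t * h * (R * h * (2 / (s * (r * t)))) = R * (2 / (s * r)) * t" if "h * h = t" for h R s :: real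
        using \<open>t > 0\<close> r by (simp flip: that)
      ultimately show ?thesis using that by (simp add: c_def)
    qed
    have "Bessel_J (1 / 2) (of_real (r * t)) = of_real ((r * t / 2) powr (1 / 2) * (2 / (sqrt pi * (r * t))) * sin (r * t))"
      using that r by (intro Bessel_J_one_half) auto
    moreover have "1 - 1 / 2 = (1 / 2 :: real)" by simp
    ultimately have "of_real (t powr (1 + 1 / 2)) * exp (- p / of_real t) / of_real (exp t - 1) * Bessel_J (1 - 1 / 2) (of_real (r * t))
       = of_real (t powr (1 + 1 / 2) * ((r * t / 2) powr (1 / 2) * (2 / (sqrt pi * (r * t))))) * of_real (sin (r * t)) *
          (exp (- p / of_real t) / of_real (exp t - 1))"
      by (simp only: of_real_mult divide_inverse mult_ac)
    thus ?thesis unfolding pw by (simp add: mult_ac)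
  qed
  hence "ext_Mathieu 1 p r = of_real (sqrt pi / ((2 * r) powr (1 - 1 / 2) * Gamma (1 + 1))) *
      (LINT t:{0<..}|lborel. of_real c * ?g t)"
    unfolding ext_Mathieu_def by (intro arg_cong2[where f = "(*)"] refl set_lebesgue_integral_cong) auto
  also have "\<dots> = of_real (sqrt pi / ((2 * r) powr (1 - 1 / 2) * Gamma (1 + 1)) * c) * (LINT t:{0<..}|lborel. ?g t)"
    by (simp only: set_integral_mult_right of_real_mult mult.assoc)
  also have "sqrt pi / ((2 * r) powr (1 - 1 / 2) * Gamma (1 + 1)) * c = 1 / r"
  proof -
    have "Gamma (1 + 1 :: real) = 1" using Gamma_numeral[of "Num.Bit0 Num.One", where 'a = real] by simp
    moreover have "(2 * r) powr (1 - 1 / 2) = 2 * (r / 2) powr (1 / 2)"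
    proof -
      have "(2 * r) powr (1 / 2) = (4 * (r / 2)) powr (1 / 2)" by simp
      also have "\<dots> = 4 powr (1 / 2) * (r / 2) powr (1 / 2)" by (rule powr_mult)
      also have "4 powr (1 / 2) = (2::real)" by (simp add: powr_half_sqrt)
      finally show ?thesis by simp
    qed
    ultimately show ?thesis using r by (simp add: c_def)
  qed
  finally show ?thesis .
qed

text \<open>
The two terms of \<open>sin x / x - cos x\<close> with \<open>x = r t\<close>: the first lowers the power of \<open>t\<close> by one and
reproduces the integral of order 1.
\<close>

lemma ext_Mathieu_2:
  assumes r: "r > 0" and p: "Re p > 0"
  shows "ext_Mathieu 2 p r = 1 / (2 * of_real r) ^ 2 * ext_Mathieu 1 p r - 1 / (2 * of_real r) ^ 2 *
     (LINT t:{0<..}|lborel. of_real (cos (r * t)) * (of_real (t powr (3 - 1)) * exp (- p / of_real t) / of_real (exp t - 1)))"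
proof -
  define c where "c = (r / 2) powr (3 / 2) * (4 / sqrt pi) / r\<^sup>2"
  let ?S = "\<lambda>t. of_real (sin (r * t)) * (of_real (t powr (2 - 1)) * exp (- p / of_real t) / of_real (exp t - 1))"
  let ?C = "\<lambda>t. of_real (cos (r * t)) * (of_real (t powr (3 - 1)) * exp (- p / of_real t) / of_real (exp t - 1))"
  have "of_real (t powr (2 + 1 / 2)) * exp (- p / of_real t) / of_real (exp t - 1) * Bessel_J (2 - 1 / 2) (of_real (r * t))
      = of_real c * (of_real (1 / r) * ?S t - ?C t)" if t: "t > 0" for t
  proof -
    have pw: "t powr (2 + 1 / 2) * ((r * t / 2) powr (3 / 2) * (4 / sqrt pi) * ((sin (r * t) / (r * t) - cos (r * t)) / (r * t)\<^sup>2))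
        = c * (1 / r * (sin (r * t) * t powr (2 - 1)) - cos (r * t) * t powr (3 - 1))"
    proof -
      have "(r * t / 2) powr (3 / 2) = (r / 2) powr (3 / 2) * t powr (3 / 2)"
        using r t by (simp flip: powr_mult)
      moreover have "t powr (2 + 1 / 2) * t powr (3 / 2) = t powr 4" by (simp flip: powr_add)
      hence "t powr (2 + 1 / 2) * t powr (3 / 2) = t ^ 4" using t by (simp add: powr_numeral)
      moreover have "t powr (3 - 1) = t\<^sup>2" "t powr (2 - 1) = t" using t by (simp_all add: powr_numeral)
      moreover have "g * (R * h * k * ((x / (r * t) - y) / (r * t)\<^sup>2)) = R * k / r\<^sup>2 * (1 / r * (x * t) - y * t\<^sup>2)"
        if "g * h = t ^ 4" for g h k R x y :: real
      proof -
        have "g * (R * h * k * ((x / (r * t) - y) / (r * t)\<^sup>2)) = (g * h) * (R * k * ((x / (r * t) - y) / (r * t)\<^sup>2))"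
          by (simp only: mult_ac)
        also have "\<dots> = R * k / r\<^sup>2 * (1 / r * (x * t) - y * t\<^sup>2)"
          unfolding that using r t by (simp add: field_simps power2_eq_square power4_eq_xxxx)
        finally show ?thesis .
      qed
      ultimately show ?thesis by (simp only: c_def)
    qed
    have "Bessel_J (3 / 2) (of_real (r * t)) =
        of_real ((r * t / 2) powr (3 / 2) * (4 / sqrt pi) * ((sin (r * t) / (r * t) - cos (r * t)) / (r * t)\<^sup>2))"
      using t r by (intro Bessel_J_three_halves) auto
    moreover have "2 - 1 / 2 = (3 / 2 :: real)" by simp
    ultimately have "of_real (t powr (2 + 1 / 2)) * exp (- p / of_real t) / of_real (exp t - 1) * Bessel_J (2 - 1 / 2) (of_real (r * t))
       = of_real (t powr (2 + 1 / 2) * ((r * t / 2) powr (3 / 2) * (4 / sqrt pi) * ((sin (r * t) / (r * t) - cos (r * t)) / (r * t)\<^sup>2))) *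
          (exp (- p / of_real t) / of_real (exp t - 1))"
      by (simp only: of_real_mult divide_inverse mult_ac)
    also have "\<dots> = of_real c * (of_real (1 / r) * ?S t - ?C t)"
      unfolding pw by (simp add: left_diff_distrib right_diff_distrib mult_ac)
    finally show ?thesis .
  qed
  hence "ext_Mathieu 2 p r = of_real (sqrt pi / ((2 * r) powr (2 - 1 / 2) * Gamma (2 + 1))) *
      (LINT t:{0<..}|lborel. of_real c * (of_real (1 / r) * ?S t - ?C t))"
    unfolding ext_Mathieu_def by (intro arg_cong2[where f = "(*)"] refl set_lebesgue_integral_cong) auto
  also have "\<dots> = of_real (sqrt pi / ((2 * r) powr (2 - 1 / 2) * Gamma (2 + 1)) * c) *
      (LINT t:{0<..}|lborel. of_real (1 / r) * ?S t - ?C t)"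
    by (simp only: set_integral_mult_right of_real_mult mult.assoc)
  also have "(LINT t:{0<..}|lborel. of_real (1 / r) * ?S t - ?C t) =
      of_real (1 / r) * (LINT t:{0<..}|lborel. ?S t) - (LINT t:{0<..}|lborel. ?C t)"
  proof (subst set_integral_diff)
    show "set_integrable lborel {0<..} (\<lambda>t. of_real (1 / r) * ?S t)"
      by (intro set_integrable_mult_right Planck_expansion(1)[OF p] continuous_intros) auto
    show "set_integrable lborel {0<..} ?C"
      by (intro Planck_expansion(1)[OF p] continuous_intros) auto
  qed (simp only: set_integral_mult_right)
  also have "of_real (1 / r) * (LINT t:{0<..}|lborel. ?S t) = ext_Mathieu 1 p r"
    by (rule ext_Mathieu_1[OF r, symmetric])
  also have "sqrt pi / ((2 * r) powr (2 - 1 / 2) * Gamma (2 + 1)) * c = 1 / (2 * r)\<^sup>2"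
  proof -
    have "Gamma (2 + 1 :: real) = 2" using Gamma_numeral[of "Num.Bit1 Num.One", where 'a = real] by (simp add: fact_numeral)
    moreover have "(2 * r) powr (2 - 1 / 2) = 8 * (r / 2) powr (3 / 2)"
    proof -
      have "(2 * r) powr (3 / 2) = (4 * (r / 2)) powr (3 / 2)" by simp
      also have "\<dots> = 4 powr (3 / 2) * (r / 2) powr (3 / 2)" by (rule powr_mult)
      also have "4 powr (3 / 2) = (8::real)"
      proof -
        have "4 powr (3 / 2) = (2 powr 2) powr (3 / 2 :: real)" by simp
        also have "\<dots> = 2 powr 3" by (simp only: powr_powr) simp
        finally show ?thesis by simp
      qed
      finally show ?thesis by simp
    qed
    ultimately show ?thesis using r by (simp add: c_def power2_eq_square)
  qed
  finally show ?thesis by (simp add: right_diff_distrib)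
qed

text \<open>
Splitting the cosine into exponentials shifts the scale \<open>n + 1\<close> by \<open>ir\<close> and \<open>- ir\<close>.
\<close>

lemma cosine_moment_eq_Bessel_K:
  fixes p :: complex and r :: real
  assumes p: "Re p > 0"
  shows "(LINT t:{0<..}|lborel. of_real (cos (r * t)) *
            (of_real (t powr (3 - 1)) * exp (- of_nat (Suc n) * of_real t) * exp (- p / of_real t))) =
     p powr (3 / 2) *
       (Bessel_K 3 (2 * csqrt (p * (of_nat (Suc n) + \<i> * of_real r))) / (of_nat (Suc n) + \<i> * of_real r) powr (3 / 2)
      + Bessel_K 3 (2 * csqrt (p * (of_nat (Suc n) - \<i> * of_real r))) / (of_nat (Suc n) - \<i> * of_real r) powr (3 / 2))"
proof -
  let ?a = "of_nat (Suc n) + \<i> * of_real r" and ?b = "of_nat (Suc n) - \<i> * of_real r"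
  let ?M = "\<lambda>a t. complex_of_real (t powr (3 - 1)) * exp (- a * of_real t) * exp (- p / of_real t)"
  have ab: "Re ?a > 0" "Re ?b > 0" by simp_all
  have int: "set_integrable lborel {0<..} (?M a)" if a: "Re a > 0" for a
  proof (rule set_integrable_bound[OF set_integrable_Gamma_scaled[of 3 "Re a"]])
    show "set_borel_measurable lborel {0<..} (?M a)"
      by (intro set_borel_measurable_continuous continuous_intros) auto
    show "AE t in lborel. t \<in> {0<..} \<longrightarrow> norm (?M a t) \<le> norm (t powr (3 - 1) * exp (- Re a * t))"
    proof (intro AE_I2 impI)
      fix t :: real assume "t \<in> {0<..}"
      hence "norm (exp (- p / of_real t)) \<le> 1" using p by simp
      moreover have "norm (exp (- a * of_real t)) = norm (exp (- Re a * t))" by simp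
      ultimately show "norm (?M a t) \<le> norm (t powr (3 - 1) * exp (- Re a * t))"
        by (simp only: norm_mult norm_of_real real_norm_def abs_mult) (intro mult_right_le_one_le, auto)
    qed
  qed (use a in auto)
  have K: "(LINT t:{0<..}|lborel. ?M a t) = 2 * p powr (3 / 2) * (Bessel_K 3 (2 * csqrt (p * a)) / a powr (3 / 2))"
    if a: "Re a > 0" for a
  proof -
    have e: "- of_real 3 / 2 = - (3 / 2 :: complex)" "of_real 3 / 2 = (3 / 2 :: complex)" by simp_all
    have "(LINT t:{0<..}|lborel. ?M a t) = Macdonald_integral 3 a p" by (simp only: Macdonald_integral_def)
    also have "\<dots> = 2 * (p powr (of_real 3 / 2) * a powr (- of_real 3 / 2)) * Bessel_K 3 (2 * csqrt (p * a))"
      by (rule Macdonald_integral_eq_Bessel_K[OF a p]) simp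
    also have "\<dots> = 2 * (p powr (3 / 2) * inverse (a powr (3 / 2))) * Bessel_K 3 (2 * csqrt (p * a))"
      by (simp only: e powr_minus)
    finally show ?thesis by (simp only: divide_inverse mult_ac)
  qed
  have "of_real (cos (r * t)) * ?M (of_nat (Suc n)) t = 1 / 2 * (?M ?a t + ?M ?b t)" for t
  proof -
    have "of_real (cos (r * t)) = (exp (\<i> * of_real (r * t)) + exp (- (\<i> * of_real (r * t)))) / 2"
      unfolding cos_of_real[symmetric] cos_exp_eq ..
    moreover have "exp (- ?b * of_real t) = exp (- of_nat (Suc n) * of_real t) * exp (\<i> * of_real (r * t))"
      unfolding exp_add[symmetric] by (intro arg_cong[where f = exp]) (simp add: algebra_simps)
    moreover have "exp (- ?a * of_real t) = exp (- of_nat (Suc n) * of_real t) * exp (- (\<i> * of_real (r * t)))"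
      unfolding exp_add[symmetric] by (intro arg_cong[where f = exp]) (simp add: algebra_simps)
    moreover have "(x + y) / 2 * (w * e * q) = 1 / 2 * (w * (e * y) * q + w * (e * x) * q)" for x y w e q :: complex
      by (simp add: algebra_simps)
    ultimately show ?thesis by (simp only:)
  qed
  hence "(LINT t:{0<..}|lborel. of_real (cos (r * t)) * ?M (of_nat (Suc n)) t) = (LINT t:{0<..}|lborel. 1 / 2 * (?M ?a t + ?M ?b t))"
    by (simp only:)
  also have "\<dots> = 1 / 2 * ((LINT t:{0<..}|lborel. ?M ?a t) + (LINT t:{0<..}|lborel. ?M ?b t))"
    by (simp only: set_integral_mult_right set_integral_add(2)[OF int[OF ab(1)] int[OF ab(2)]])
  also have "\<dots> = p powr (3 / 2) * (Bessel_K 3 (2 * csqrt (p * ?a)) / ?a powr (3 / 2) + Bessel_K 3 (2 * csqrt (p * ?b)) / ?b powr (3 / 2))"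
    unfolding K[OF ab(1)] K[OF ab(2)] by (simp add: distrib_left)
  finally show ?thesis .
qed

theorem theorem4:
  fixes p :: complex and r :: real
  assumes "Re p > 0" and "r > 0"
  shows "summable (\<lambda>n.
           Bessel_K 3 (2 * csqrt (p * (of_nat (Suc n) + \<i> * of_real r)))
             / (of_nat (Suc n) + \<i> * of_real r) powr (3 / 2)
         + Bessel_K 3 (2 * csqrt (p * (of_nat (Suc n) - \<i> * of_real r)))
             / (of_nat (Suc n) - \<i> * of_real r) powr (3 / 2))
    \<and> ext_Mathieu 2 p r =
         1 / (2 * of_real r) ^ 2 * ext_Mathieu 1 p r
       - p powr (3 / 2) / (2 * of_real r) ^ 2 *
         (\<Sum>n.
           Bessel_K 3 (2 * csqrt (p * (of_nat (Suc n) + \<i> * of_real r)))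
             / (of_nat (Suc n) + \<i> * of_real r) powr (3 / 2)
         + Bessel_K 3 (2 * csqrt (p * (of_nat (Suc n) - \<i> * of_real r)))
             / (of_nat (Suc n) - \<i> * of_real r) powr (3 / 2))"
proof -
  let ?T = "\<lambda>n. Bessel_K 3 (2 * csqrt (p * (of_nat (Suc n) + \<i> * of_real r)))
             / (of_nat (Suc n) + \<i> * of_real r) powr (3 / 2)
         + Bessel_K 3 (2 * csqrt (p * (of_nat (Suc n) - \<i> * of_real r)))
             / (of_nat (Suc n) - \<i> * of_real r) powr (3 / 2)"
  define G where "G = (LINT t:{0<..}|lborel. of_real (cos (r * t)) *
      (of_real (t powr (3 - 1)) * exp (- p / of_real t) / of_real (exp t - 1)))"
  have p0: "p powr (3 / 2) \<noteq> 0" using assms by auto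
  have "(\<lambda>n. LINT t:{0<..}|lborel. of_real (cos (r * t)) *
        (of_real (t powr (3 - 1)) * exp (- of_nat (Suc n) * of_real t) * exp (- p / of_real t))) sums G"
    unfolding G_def by (rule Planck_expansion(2)[OF assms(1)]) (auto intro!: continuous_intros)
  hence S: "(\<lambda>n. p powr (3 / 2) * ?T n) sums G"
    unfolding cosine_moment_eq_Bessel_K[OF assms(1)] .
  have sm: "summable ?T"
    using sums_summable[OF S] p0 by (subst (asm) summable_cmult_iff) blast
  moreover have "G = p powr (3 / 2) * (\<Sum>n. ?T n)"
    by (rule sums_unique2[OF S sums_mult[OF summable_sums[OF sm]]])
  ultimately show ?thesis
    using ext_Mathieu_2[OF assms(2,1)] unfolding G_def[symmetric] by simp
qed

end
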